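(* Let $J>1$ be an integer, $T>0$, $K>0$, and for each $j\in\{1,\ldots,J\}$ let $\lambda^j>0$, $\alpha^j\ge 0$, and let $f^j$ be a probability density on $(0,+\infty)$ with cumulative distribution function $F^j$ (so $F^j(0)=0$), such that $f^j(p)>0$ for all $p>0$ and $\lim_{p\to+\infty}p^3f^j(p)=0$ (superscripts $j$ are indices, not exponents). For $(t,S)\in[0,T]\times\mathbb{R}$ let $$\tilde v(t,S)=\inf_{(\tilde b^1_s,\ldots,\tilde b^J_s)_{s\in[t,T]}}\left\{-\sum_{j=1}^J\lambda^j\alpha^j\int_t^T F^j(\tilde b^j_s)\,ds+K\min\left(\tilde S^{\tilde b,t,S}_T,0\right)^2\right\},$$ where the infimum is over deterministic measurable controls $\tilde b=(\tilde b^1,\ldots,\tilde b^J):[t,T]\to(\mathbb{R}_+\cup\{+\infty\})^J$ and $$d\tilde S^{\tilde b,t,S}_s=-\sum_{j=1}^J\lambda^jG^j(\tilde b^j_s)\,ds,\qquad \tilde S^{\tilde b,t,S}_t=S,\qquad G^j(x)=\int_0^x p f^j(p)\,dp\quad (x\in\mathbb{R}_+\cup\{+\infty\}).$$ Define, for $x\in\mathbb{R}$, $$H^j(x)=\lambda^j\sup_{b^j\in\mathbb{R}_+}\int_0^{b^j}f^j(p)(\alpha^j+xp)\,dp\quad (j=1,\ldots,J),\qquad H=H^1+\cdots+H^J.$$ Then the value function is given by $$\tilde v(t,S)=\sup_{x\le 0}\left(Sx-(T-t)H(x)-\frac{x^2}{4K}\right).$$ It is the unique weak semi-concave solution of the Hamilton-Jacobi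 equation $$-\partial_t v(t,S)-\sum_{j=1}^J\lambda^j\inf_{b^j\in\mathbb{R}_+}\left(-\int_0^{b^j}f^j(p)\left(\alpha^j+p\,\partial_S v(t,S)\right)dp\right)=0,\qquad v(T,S)=K\min(S,0)^2.$$ Furthermore, the optimal control function $(t,S)\mapsto\tilde b^*(t,S)=(\tilde b^{1*}(t,S),\ldots,\tilde b^{J*}(t,S))$ is given by the following: (i) if $S\ge\sum_{j=1}^J\lambda^j(T-t)\int_0^\infty p f^j(p)\,dp$, then $\tilde b^{j*}(t,S)=+\infty$ for all $j\in\{1,\ldots,J\}$; (ii) if $S<\sum_{j=1}^J\lambda^j(T-t)\int_0^\infty p f^j(p)\,dp$, then $\tilde b^{j*}(t,S)=-\frac{\alpha^j}{x^*}$ for all $j\in\{1,\ldots,J\}$, where $x^*$ is characterized by $$S=(T-t)H'(x^* )+\frac{x^*}{2K}.$$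
   Context: Conventions: $F^j(+\infty)=1$ and $G^j(+\infty)=\int_0^\infty p f^j(p)\,dp$, which is finite under the assumptions on $f^j$. The optimal control function is the feedback (closed-loop) form of the optimal control: a function $\tilde b^*$ of (time, current remaining cash) such that, for every starting point $(t,S)$, the control $\tilde b_s=\tilde b^*(s,\tilde S_s)$, with $\tilde S$ the corresponding state trajectory started from $S$ at time $t$, attains the infimum defining $\tilde v(t,S)$. Weak semi-concave solution (standard notion for first-order Hamilton-Jacobi equations with convex Hamiltonian, written here with a terminal condition): a locally Lipschitz function $v$ on $[0,T]\times\mathbb{R}$ that satisfies the terminal condition, satisfies the equation at almost every $(t,S)$, and is semi-concave in $S$, i.e. there is a constant $C\ge 0$ such that $v(t,S+z)-2v(t,S)+v(t,S-z)\le C\left(1+\frac{1}{T-t}\right)z^2$ for all $t\in[0,T)$ and $S,z\in\mathbb{R}$.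
   Formalization: If some α^j=0, H has a kink at 0 and for some S in case (ii) no x* solves S=(T-t)H'(x* )+x*/(2K); there H'(x* ) is read as an element of the subdifferential, x*=0, and -α^j/x* means +∞ if α^j>0 and 0 if α^j=0; elsewhere the equation is literal. *)

theory Defs
  imports "HOL-Analysis.Analysis"
begin

text \<open>
  Throughout, the superscript index j ranges over {1..J}, \<open>lam j\<close> and \<open>\<alpha> j\<close> are the
  parameters \<open>\<lambda>\<^sup>j\<close> and \<open>\<alpha>\<^sup>j\<close>, and \<open>f j\<close> is the density \<open>f\<^sup>j\<close>. Densities are functions on the
  open half-line: their values at nonpositive arguments are never used. Control values live in
  \<open>ennreal\<close>, which is exactly the set of nonnegative reals together with infinity.
\<close>

definition density_on_pos :: "(real \<Rightarrow> real) \<Rightarrow> bool" where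
  "density_on_pos f \<longleftrightarrow>
     set_integrable lborel {0<..} f \<and> (\<forall>p>0. 0 \<le> f p) \<and> (LINT p:{0<..}|lborel. f p) = 1"

text \<open>
  The functions F and G of the text, extended to infinity by the integral over the whole half-line.
\<close>

definition F_ext :: "(real \<Rightarrow> real) \<Rightarrow> ennreal \<Rightarrow> real" where
  "F_ext f x = (LINT p:{p. 0 < p \<and> ennreal p \<le> x}|lborel. f p)"

definition G_ext :: "(real \<Rightarrow> real) \<Rightarrow> ennreal \<Rightarrow> real" where
  "G_ext f x = (LINT p:{p. 0 < p \<and> ennreal p \<le> x}|lborel. p * f p)"

definition admissible :: "nat \<Rightarrow> real \<Rightarrow> real \<Rightarrow> (nat \<Rightarrow> real \<Rightarrow> ennreal) \<Rightarrow> bool" where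
  "admissible J T t b \<longleftrightarrow> (\<forall>j\<in>{1..J}. b j \<in> borel_measurable (lebesgue_on {t..T}))"

definition state ::
  "nat \<Rightarrow> (nat \<Rightarrow> real) \<Rightarrow> (nat \<Rightarrow> real \<Rightarrow> real) \<Rightarrow> (nat \<Rightarrow> real \<Rightarrow> ennreal)
     \<Rightarrow> real \<Rightarrow> real \<Rightarrow> real \<Rightarrow> real" where
  "state J lam f b t S s =
     S - (\<Sum>j=1..J. lam j * (LINT u:{t..s}|lebesgue. G_ext (f j) (b j u)))"

definition cost ::
  "nat \<Rightarrow> real \<Rightarrow> real \<Rightarrow> (nat \<Rightarrow> real) \<Rightarrow> (nat \<Rightarrow> real) \<Rightarrow> (nat \<Rightarrow> real \<Rightarrow> real)
     \<Rightarrow> (nat \<Rightarrow> real \<Rightarrow> ennreal) \<Rightarrow> real \<Rightarrow> real \<Rightarrow> real" where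
  "cost J T K lam \<alpha> f b t S =
     - (\<Sum>j=1..J. lam j * \<alpha> j * (LINT s:{t..T}|lebesgue. F_ext (f j) (b j s)))
     + K * (min (state J lam f b t S T) 0)\<^sup>2"

definition value_fun ::
  "nat \<Rightarrow> real \<Rightarrow> real \<Rightarrow> (nat \<Rightarrow> real) \<Rightarrow> (nat \<Rightarrow> real) \<Rightarrow> (nat \<Rightarrow> real \<Rightarrow> real)
     \<Rightarrow> real \<Rightarrow> real \<Rightarrow> real" where
  "value_fun J T K lam \<alpha> f t S =
     (INF b\<in>{b. admissible J T t b}. cost J T K lam \<alpha> f b t S)"

definition H_single :: "real \<Rightarrow> real \<Rightarrow> (real \<Rightarrow> real) \<Rightarrow> real \<Rightarrow> real" where
  "H_single l a f x = l * (SUP b\<in>{0..}. LINT p:{0<..b}|lborel. f p * (a + x * p))"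

definition hamiltonian ::
  "nat \<Rightarrow> (nat \<Rightarrow> real) \<Rightarrow> (nat \<Rightarrow> real) \<Rightarrow> (nat \<Rightarrow> real \<Rightarrow> real) \<Rightarrow> real \<Rightarrow> real" where
  "hamiltonian J lam \<alpha> f x = (\<Sum>j=1..J. H_single (lam j) (\<alpha> j) (f j) x)"

definition locally_lipschitz_on :: "'a::metric_space set \<Rightarrow> ('a \<Rightarrow> 'b::metric_space) \<Rightarrow> bool" where
  "locally_lipschitz_on X g \<longleftrightarrow> (\<forall>z\<in>X. \<exists>u>0. \<exists>L. L-lipschitz_on (cball z u \<inter> X) g)"

text \<open>
  Weak semi-concave solutions of the Hamilton-Jacobi equation. Almost everywhere satisfaction
  includes the existence of both partial derivatives at almost every point.
\<close>

definition weak_semiconcave_solution ::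
  "nat \<Rightarrow> real \<Rightarrow> real \<Rightarrow> (nat \<Rightarrow> real) \<Rightarrow> (nat \<Rightarrow> real) \<Rightarrow> (nat \<Rightarrow> real \<Rightarrow> real)
     \<Rightarrow> (real \<Rightarrow> real \<Rightarrow> real) \<Rightarrow> bool" where
  "weak_semiconcave_solution J T K lam \<alpha> f v \<longleftrightarrow>
     locally_lipschitz_on ({0..T} \<times> UNIV) (\<lambda>(t, S). v t S) \<and>
     (\<forall>S. v T S = K * (min S 0)\<^sup>2) \<and>
     (AE (t, S) in (lborel :: (real \<times> real) measure). 0 < t \<and> t < T \<longrightarrow>
        (\<exists>vt vS. ((\<lambda>r. v r S) has_real_derivative vt) (at t) \<and>
                 ((\<lambda>x. v t x) has_real_derivative vS) (at S) \<and>
                 - vt - (\<Sum>j=1..J. lam j *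
                    (INF b\<in>{0..}. - (LINT p:{0<..b}|lborel. f j p * (\<alpha> j + p * vS)))) = 0)) \<and>
     (\<exists>C\<ge>0. \<forall>t S z. 0 \<le> t \<and> t < T \<longrightarrow>
        v t (S + z) - 2 * v t S + v t (S - z) \<le> C * (1 + 1 / (T - t)) * z\<^sup>2)"

text \<open>
  Feedback controls \<open>\<beta> j s x\<close> (asset index, time, remaining cash): X is a state trajectory started
  from S at time t and driven by \<open>\<beta>\<close> in closed loop. Optimality of \<open>\<beta>\<close> asks that such
  trajectories exist from every starting point, and that the resulting control is a minimiser.
\<close>

definition closed_loop_trajectory ::
  "nat \<Rightarrow> real \<Rightarrow> (nat \<Rightarrow> real) \<Rightarrow> (nat \<Rightarrow> real \<Rightarrow> real) \<Rightarrow> (nat \<Rightarrow> real \<Rightarrow> real \<Rightarrow> ennreal)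
     \<Rightarrow> real \<Rightarrow> real \<Rightarrow> (real \<Rightarrow> real) \<Rightarrow> bool" where
  "closed_loop_trajectory J T lam f \<beta> t S X \<longleftrightarrow>
     admissible J T t (\<lambda>j s. \<beta> j s (X s)) \<and>
     (\<forall>s\<in>{t..T}. X s = state J lam f (\<lambda>j s. \<beta> j s (X s)) t S s)"

definition optimal_control_function ::
  "nat \<Rightarrow> real \<Rightarrow> real \<Rightarrow> (nat \<Rightarrow> real) \<Rightarrow> (nat \<Rightarrow> real) \<Rightarrow> (nat \<Rightarrow> real \<Rightarrow> real)
     \<Rightarrow> (nat \<Rightarrow> real \<Rightarrow> real \<Rightarrow> ennreal) \<Rightarrow> bool" where
  "optimal_control_function J T K lam \<alpha> f \<beta> \<longleftrightarrow>
     (\<forall>t\<in>{0..T}. \<forall>S.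
        (\<exists>X. closed_loop_trajectory J T lam f \<beta> t S X) \<and>
        (\<forall>X. closed_loop_trajectory J T lam f \<beta> t S X \<longrightarrow>
           cost J T K lam \<alpha> f (\<lambda>j s. \<beta> j s (X s)) t S = value_fun J T K lam \<alpha> f t S))"

text \<open>
  The set of slopes of a convex function at a point; it is the singleton of the derivative
  wherever the function is differentiable. It is needed because some \<open>\<alpha> j\<close> may vanish, and then
  the Hamiltonian has a kink at 0.
\<close>

definition subdifferential :: "(real \<Rightarrow> real) \<Rightarrow> real \<Rightarrow> real set" where
  "subdifferential h x = {d. \<forall>y. h x + d * (y - x) \<le> h y}"

end

theory Submission
  imports Defs
begin

text \<open>
  Duality: for every slope \<open>x \<le> 0\<close>, the inequality \<open>K * (min y 0)\<^sup>2 \<ge> x * y - x\<^sup>2 / (4 * K)\<close> and the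
  definition of H as a supremum bound the cost of any control below by
  \<open>S * x - (T - t) * H x - x\<^sup>2 / (4 * K)\<close>. The maximiser of this strongly concave function of x
  satisfies the first order condition that makes the bound sharp for the constant control \<open>-\<alpha> j / x\<close>. It is
  Lipschitz in (t, S) and equals the S-derivative of the value function, which is therefore a
  classical solution. In closed loop the cash is spent at a rate that is nondecreasing in the
  remaining cash, so trajectories are unique.

  H may have a kink at 0 and an unbounded second derivative, so the uniqueness of weak solutions is
  not obtained from a transport equation for the difference of two solutions. A weak solution lies below
  the value function because, averaged over small intervals of S, it grows along straight
  characteristics at least as fast as the linear minorants of H dictate. It lies above each affine solution
  \<open>S * x - (T - t) * H x - x\<^sup>2 / (4 * K)\<close>: at a minimum of the penalised difference, semi-concavity bounds
  the S-derivatives at all nearby points of differentiability from above, and hence also the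
  t-derivatives, because H is nondecreasing.
\<close>

section \<open>Integrated differential inequalities\<close>

text \<open>An equation that holds almost everywhere says nothing on a single line or at a single
  point, since these are null sets. Both halves of the comparison therefore use it only through
  integrals over small boxes and return to a point by the Lipschitz bound. Derivatives enter as
  difference quotients, whose integrals over a box telescope to boundary terms. Affine solutions
  suffice for the lower bound because the value function is their supremum over
  \<open>x \<le> 0\<close> and each of them lies below the terminal penalty. For the upper bound,
  the linear minorant of H given by the controls \<open>-\<alpha> j / x\<close> is exact at the
  maximising \<open>x\<close>, and its characteristic is the trajectory of that constant control.
  Because of the kink of H at 0, the equation for the maximiser is replaced by a first order
  condition with an inequality at the boundary point 0. The same kink can make the feedback rate
  jump, so the closed-loop state is written down explicitly instead of being obtained from a fixed
  point argument.\<close>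

lemma continuous_on_if_abs_diff_le:
  fixes g :: "real \<Rightarrow> real"
  assumes "\<And>x y. \<bar>g x - g y\<bar> \<le> L * \<bar>x - y\<bar>"
  shows "continuous_on X g"
proof -
  have "0 \<le> L" using assms[of 0 1] by (auto intro: order_trans[OF abs_ge_zero])
  hence "L-lipschitz_on X g"
    using assms by (intro lipschitz_onI) (auto simp: dist_real_def)
  thus ?thesis by (rule lipschitz_on_continuous_on)
qed

lemma integral_initial_segment_approx:
  fixes g :: "real \<Rightarrow> real"
  assumes lip: "\<And>x y. \<bar>g x - g y\<bar> \<le> L * \<bar>x - y\<bar>" and d: "d \<ge> 0"
  shows "\<bar>integral {c..c+d} g - d * g c\<bar> \<le> L * d\<^sup>2"
proof -
  note cont = continuous_on_if_abs_diff_le[OF lip]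
  have L0: "0 \<le> L" using lip[of 0 1] by (auto intro: order_trans[OF abs_ge_zero])
  have "integral {c..c+d} g - d * g c = integral {c..c+d} (\<lambda>x. g x - g c)"
    using d by (subst integral_diff) (auto intro!: integrable_continuous_interval cont)
  also have "\<bar>\<dots>\<bar> \<le> L * d * (c + d - c)"
  proof (rule integral_bound[where 'a=real, simplified real_norm_def])
    show "continuous_on {c..c+d} (\<lambda>x. g x - g c)" by (intro continuous_intros cont)
    fix x assume "x \<in> {c..c+d}"
    thus "\<bar>g x - g c\<bar> \<le> L * d" 
      using L0 by (intro order_trans[OF lip] mult_left_mono) auto
  qed (use d in auto)
  finally show ?thesis by (simp add: power2_eq_square)
qed

text \<open>The integral of the shifted function is the integral over the shifted interval, so
  everything cancels except two end segments of length \<open>d\<close>. Each of them is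
  \<open>d\<close> times an end value up to \<open>L * d\<^sup>2\<close>.\<close>

lemma integral_shift_difference_approx:
  fixes g :: "real \<Rightarrow> real"
  assumes lip: "\<And>x y. \<bar>g x - g y\<bar> \<le> L * \<bar>x - y\<bar>" and d: "d \<ge> 0" and ab: "a \<le> b"
  shows "\<bar>integral {a..b} (\<lambda>x. g (x + d) - g x) - d * (g b - g a)\<bar> \<le> 2 * L * d\<^sup>2"
proof -
  note cont = continuous_on_if_abs_diff_le[OF lip]
  have int: "g integrable_on {x..y}" for x y by (intro integrable_continuous_interval cont)
  have "(g has_integral integral {a+d..b+d} g) (cbox (a+d) (b+d))"
    using integrable_integral[OF int] by simp
  from has_integral_shift_cbox[OF this, of d]
  have sh: "((\<lambda>x. g (x + d)) has_integral integral {a+d..b+d} g) {a..b}" by simp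
  have "integral {a..b} (\<lambda>x. g (x + d) - g x) = integral {a+d..b+d} g - integral {a..b} g"
    using sh int by (intro integral_unique has_integral_diff) (auto intro: integrable_integral)
  also have "\<dots> = integral {b..b+d} g - integral {a..a+d} g"
    using Henstock_Kurzweil_Integration.integral_combine[of a "a+d" "b+d" g] Henstock_Kurzweil_Integration.integral_combine[of a b "b+d" g] d ab int by auto
  finally show ?thesis
    using integral_initial_segment_approx[OF lip d, of a] integral_initial_segment_approx[OF lip d, of b]
    by (simp add: algebra_simps abs_le_iff)
qed

lemma continuous_on_pair_if_abs_diff_le:
  fixes u :: "real \<Rightarrow> real \<Rightarrow> real"
  assumes lip: "\<And>s y s' y'. \<bar>u s y - u s' y'\<bar> \<le> L * (\<bar>s - s'\<bar> + \<bar>y - y'\<bar>)"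
  shows "continuous_on X (\<lambda>z. u (fst z) (snd z))"
proof -
  have L0: "0 \<le> L" using lip[of 0 0 1 0] by (auto intro: order_trans[OF abs_ge_zero])
  have "(2 * L)-lipschitz_on X (\<lambda>z. u (fst z) (snd z))"
  proof (rule lipschitz_onI)
    fix z z' :: "real \<times> real"
    have "dist (u (fst z) (snd z)) (u (fst z') (snd z')) \<le> L * (dist (fst z) (fst z') + dist (snd z) (snd z'))"
      using lip by (simp add: dist_real_def)
    also have "\<dots> \<le> L * (dist z z' + dist z z')"
      using L0 by (intro mult_left_mono add_mono dist_fst_le dist_snd_le)
    finally show "dist (u (fst z) (snd z)) (u (fst z') (snd z')) \<le> 2 * L * dist z z'" by simp
  qed (use L0 in simp)
  thus ?thesis by (rule lipschitz_on_continuous_on)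
qed

lemma continuous_on_compose_pair_if_abs_diff_le:
  fixes u :: "real \<Rightarrow> real \<Rightarrow> real" and p q :: "'a::topological_space \<Rightarrow> real"
  assumes lip: "\<And>s y s' y'. \<bar>u s y - u s' y'\<bar> \<le> L * (\<bar>s - s'\<bar> + \<bar>y - y'\<bar>)"
    and "continuous_on X p" "continuous_on X q"
  shows "continuous_on X (\<lambda>z. u (p z) (q z))"
  using continuous_on_compose2[OF continuous_on_pair_if_abs_diff_le[OF lip, of UNIV], of X "\<lambda>z. (p z, q z)"] assms(2,3)
  by (auto intro!: continuous_intros)

lemma integral_box_shift_difference_approx:
  fixes u :: "real \<Rightarrow> real \<Rightarrow> real"
  assumes lip: "\<And>s y s' y'. \<bar>u s y - u s' y'\<bar> \<le> L * (\<bar>s - s'\<bar> + \<bar>y - y'\<bar>)"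
    and d: "d \<ge> 0" and ab: "a \<le> b" and t: "t1 \<le> t2"
  shows "\<bar>integral (cbox (t1, a) (t2, b)) (\<lambda>(s, y). u s (y + d) - u s y)
           - d * integral {t1..t2} (\<lambda>s. u s b - u s a)\<bar> \<le> 2 * L * d\<^sup>2 * (t2 - t1)"
proof -
  note cont = continuous_on_compose_pair_if_abs_diff_le[OF lip]
  have lip1: "\<bar>u s y - u s y'\<bar> \<le> L * \<bar>y - y'\<bar>" for s y y' using lip[of s y s y'] by simp
  have c2: "continuous_on X (\<lambda>(s, y). u s (y + d) - u s y)" for X
    unfolding case_prod_unfold by (intro continuous_intros cont)
  have c1: "continuous_on {t1..t2} (\<lambda>s. integral {a..b} (\<lambda>y. u s (y + d) - u s y))"
    using integral_continuous_on_param[of "{t1..t2}" a b "\<lambda>s y. u s (y + d) - u s y"] c2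
    by simp
  have c3: "continuous_on {t1..t2} (\<lambda>s. d * (u s b - u s a))"
    by (intro continuous_intros cont)
  have "integral (cbox (t1, a) (t2, b)) (\<lambda>(s, y). u s (y + d) - u s y)
      = integral {t1..t2} (\<lambda>s. integral {a..b} (\<lambda>y. u s (y + d) - u s y))"
    using integral_prod_continuous[OF c2, of t1 a t2 b] by simp
  hence "integral (cbox (t1, a) (t2, b)) (\<lambda>(s, y). u s (y + d) - u s y)
           - d * integral {t1..t2} (\<lambda>s. u s b - u s a)
      = integral {t1..t2} (\<lambda>s. integral {a..b} (\<lambda>y. u s (y + d) - u s y) - d * (u s b - u s a))"
    using c1 c3 by (subst integral_diff) (auto intro: integrable_continuous_interval)
  also have "norm \<dots> \<le> integral {t1..t2} (\<lambda>s. 2 * L * d\<^sup>2)"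
    using integral_shift_difference_approx[OF lip1 d ab] c1 c3
    by (intro integral_norm_bound_integral)
       (auto intro!: integrable_continuous_interval continuous_intros)
  finally show ?thesis using t by (simp add: mult_ac)
qed

lemma difference_quotient_sequence_tendsto:
  fixes g :: "real \<Rightarrow> real"
  assumes "(g has_real_derivative p) (at x)"
  shows "(\<lambda>n. real (Suc n) * (g (x + 1 / real (Suc n)) - g x)) \<longlonglongrightarrow> p"
proof -
  have "(\<lambda>h. (g (x + h) - g x) / h) \<midarrow>0\<rightarrow> p" using assms by (simp add: DERIV_def)
  moreover have "filterlim (\<lambda>n. 1 / real (Suc n)) (at 0) sequentially"
    using LIMSEQ_inverse_real_of_nat by (intro filterlim_atI) (auto simp: inverse_eq_divide)
  ultimately have "(\<lambda>n. (g (x + 1 / real (Suc n)) - g x) / (1 / real (Suc n))) \<longlonglongrightarrow> p"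
    by (rule filterlim_compose)
  thus ?thesis by (simp add: mult.commute)
qed

text \<open>Integration of the derivatives over a box, carried out on difference quotients: they are
  bounded by the Lipschitz constant and converge almost everywhere, while their integrals are the
  boundary terms up to an error of order \<open>\<delta> n\<close>. The signs of \<open>k\<close>
  and \<open>c\<close> are free: \<open>(1, - c)\<close> serves the growth along characteristics and
  \<open>(- 1, 0)\<close> an upper bound on the growth in time.\<close>

lemma integrated_differential_inequality:
  fixes u :: "real \<Rightarrow> real \<Rightarrow> real"
  assumes lip: "\<And>s y s' y'. \<bar>u s y - u s' y'\<bar> \<le> L * (\<bar>s - s'\<bar> + \<bar>y - y'\<bar>)"
    and t: "t1 \<le> t2" and ab: "a \<le> b"
    and ae: "AE (s, y) in lborel. t1 < s \<and> s < t2 \<and> a < y \<and> y < b \<longrightarrow>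
        (\<exists>p q. ((\<lambda>r. u r y) has_real_derivative p) (at s) \<and>
               ((\<lambda>x. u s x) has_real_derivative q) (at y) \<and> l \<le> k * p + c * q)"
  shows "l * (t2 - t1) * (b - a)
      \<le> k * integral {a..b} (\<lambda>y. u t2 y - u t1 y) + c * integral {t1..t2} (\<lambda>s. u s b - u s a)"
proof -
  note cont = continuous_on_compose_pair_if_abs_diff_le[OF lip]
  have lip': "\<bar>u y s - u y' s'\<bar> \<le> L * (\<bar>s - s'\<bar> + \<bar>y - y'\<bar>)" for s s' y y'
    using lip[of y s y' s'] by (simp add: add.commute)
  have L0: "0 \<le> L" using lip[of 0 0 1 0] by (auto intro: order_trans[OF abs_ge_zero])
  define \<delta> where "\<delta> n = 1 / real (Suc n)" for n
  have d: "\<delta> n > 0" "real (Suc n) * \<delta> n = 1" for n by (auto simp: \<delta>_def)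
  define gs where "gs n = (\<lambda>(s, y). u (s + \<delta> n) y - u s y)" for n
  define gy where "gy n = (\<lambda>(s, y). u s (y + \<delta> n) - u s y)" for n
  define g where "g n z = k * (real (Suc n) * gs n z) + c * (real (Suc n) * gy n z) - l" for n z
  define R where "R = box (t1, a) (t2, b)"
  have cs: "continuous_on X (gs n)" and cy: "continuous_on X (gy n)" for X n
    unfolding gs_def gy_def case_prod_unfold by (intro continuous_intros cont)+
  hence cg: "continuous_on X (g n)" for X n
    unfolding g_def by (intro continuous_intros) auto
  have R_sub: "R \<subseteq> cbox (t1, a) (t2, b)" unfolding R_def by (rule box_subset_cbox)
  have cint: "set_integrable lborel R h" if "continuous_on UNIV h" for h :: "real \<times> real \<Rightarrow> real"
  proof (rule set_integrable_subset)
    show "set_integrable lborel (cbox (t1, a) (t2, b)) h"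
      unfolding set_integrable_def
      by (intro borel_integrable_compact compact_cbox continuous_on_subset[OF that]) auto
  qed (use R_sub in \<open>auto simp: R_def\<close>)
  have Rint: "(LINT z:R|lborel. h z) = integral (cbox (t1, a) (t2, b)) h"
    if "continuous_on UNIV h" for h :: "real \<times> real \<Rightarrow> real"
    using set_borel_integral_eq_integral(2)[OF cint[OF that]]
    by (simp add: R_def integral_open_interval)
  define B where "B = (\<bar>k\<bar> + \<bar>c\<bar>) * L + \<bar>l\<bar>"
  have gb: "\<bar>g n z\<bar> \<le> B" for n z
  proof -
    have "\<bar>gs n z\<bar> \<le> L * \<delta> n" "\<bar>gy n z\<bar> \<le> L * \<delta> n"
      using lip[of "fst z + \<delta> n" "snd z" "fst z" "snd z"] lip[of "fst z" "snd z + \<delta> n" "fst z" "snd z"] d(1)[of n]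
      by (auto simp: gs_def gy_def case_prod_unfold)
    hence "real (Suc n) * \<bar>gs n z\<bar> \<le> real (Suc n) * (L * \<delta> n)"
       "real (Suc n) * \<bar>gy n z\<bar> \<le> real (Suc n) * (L * \<delta> n)" by (intro mult_left_mono; simp)+
    hence 1: "\<bar>real (Suc n) * gs n z\<bar> \<le> L" "\<bar>real (Suc n) * gy n z\<bar> \<le> L"
      using d(2)[of n] by (simp_all add: abs_mult mult.left_commute del: of_nat_Suc)
    have "\<bar>g n z\<bar> \<le> \<bar>k\<bar> * \<bar>real (Suc n) * gs n z\<bar> + \<bar>c\<bar> * \<bar>real (Suc n) * gy n z\<bar> + \<bar>l\<bar>"
      unfolding g_def abs_mult[symmetric] by linarith
    also have "\<dots> \<le> \<bar>k\<bar> * L + \<bar>c\<bar> * L + \<bar>l\<bar>" using 1 by (intro add_mono mult_left_mono) auto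
    finally show ?thesis by (simp add: B_def algebra_simps)
  qed
  \<comment> \<open>Passing to the limit in the negative parts only, whose limit is 0, avoids any discussion of the
      measurability of the partial derivatives.\<close>
  have lim0: "(\<lambda>n. LINT z:R|lborel. min (g n z) 0) \<longlonglongrightarrow> (LINT z:R|lborel. 0)"
    unfolding set_lebesgue_integral_def
  proof (rule integral_dominated_convergence)
    show "integrable lborel (\<lambda>z. indicator R z *\<^sub>R B)"
      using cint[of "\<lambda>_. B"] by (simp add: set_integrable_def)
    show "(\<lambda>z. indicator R z *\<^sub>R min (g n z) 0) \<in> borel_measurable lborel" for n
    proof -
      have "set_integrable lborel R (\<lambda>z. min (g n z) 0)"
        by (intro cint continuous_intros cg)
      thus ?thesis unfolding set_integrable_def by simp
    qed
    show "AE z in lborel. norm (indicator R z *\<^sub>R min (g n z) 0) \<le> indicator R z *\<^sub>R B" for n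
    proof (intro always_eventually allI)
      fix z show "norm (indicator R z *\<^sub>R min (g n z) 0) \<le> indicator R z *\<^sub>R B"
        using gb[of n z] by (auto simp: indicator_def)
    qed
    show "AE z in lborel. (\<lambda>n. indicator R z *\<^sub>R min (g n z) 0) \<longlonglongrightarrow> indicator R z *\<^sub>R 0"
      using ae
    proof eventually_elim
      case (elim z)
      obtain s y where z: "z = (s, y)" by force
      show ?case
      proof (cases "z \<in> R")
        case True
        then obtain p q where pq: "((\<lambda>r. u r y) has_real_derivative p) (at s)"
            "((\<lambda>x. u s x) has_real_derivative q) (at y)" "l \<le> k * p + c * q"
          using elim by (auto simp: z R_def mem_box inner_prod_def Basis_prod_def)
        have "(\<lambda>n. min (g n z) 0) \<longlonglongrightarrow> min (k * p + c * q - l) 0"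
          using difference_quotient_sequence_tendsto[OF pq(1)] difference_quotient_sequence_tendsto[OF pq(2)]
          unfolding g_def gs_def gy_def z \<delta>_def prod.case by (intro tendsto_intros)
        thus ?thesis using pq(3) by (simp add: True)
      qed simp
    qed
  qed simp
  have ge: "(LINT z:R|lborel. min (g n z) 0) \<le> integral (cbox (t1, a) (t2, b)) (g n)" for n
    unfolding Rint[OF cg, symmetric]
    by (intro set_integral_mono cint continuous_intros cg) auto
  define I where "I = k * integral {a..b} (\<lambda>y. u t2 y - u t1 y)
      + c * integral {t1..t2} (\<lambda>s. u s b - u s a) - l * (t2 - t1) * (b - a)"
  define C where "C = \<bar>k\<bar> * (2 * L * (b - a)) + \<bar>c\<bar> * (2 * L * (t2 - t1))"
  have le: "integral (cbox (t1, a) (t2, b)) (g n) \<le> I + C * \<delta> n" for n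
  proof -
    let ?i = "integral (cbox (t1, a) (t2, b))"
    have io: "h integrable_on cbox (t1, a) (t2, b)" if "continuous_on UNIV h" for h :: "real \<times> real \<Rightarrow> real"
      by (intro integrable_continuous continuous_on_subset[OF that]) auto
    have cst: "?i (\<lambda>_. l) = l * (t2 - t1) * (b - a)"
      using t ab by (simp add: content_Pair)
    have "?i (g n) = ?i (\<lambda>z. k * (real (Suc n) * gs n z) + c * (real (Suc n) * gy n z)) - ?i (\<lambda>_. l)"
      unfolding g_def by (intro integral_diff io continuous_intros cs cy)
    moreover have "?i (\<lambda>z. k * (real (Suc n) * gs n z) + c * (real (Suc n) * gy n z))
       = ?i (\<lambda>z. k * (real (Suc n) * gs n z)) + ?i (\<lambda>z. c * (real (Suc n) * gy n z))"
      by (intro integral_add io continuous_intros cs cy)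
    moreover have "?i (\<lambda>z. k' * (real (Suc n) * h z)) = k' * (real (Suc n) * ?i h)" for k' h
      unfolding integral_mult_right ..
    ultimately have eq: "?i (g n) = k * (real (Suc n) * ?i (gs n)) + c * (real (Suc n) * ?i (gy n)) - l * (t2 - t1) * (b - a)"
      using cst by presburger
    \<comment> \<open>Exchanging the coordinates lets the same shift estimate serve the time
      direction.\<close>
    have sw: "?i (gs n) = integral (cbox (a, t1) (b, t2)) (\<lambda>(y, s). u (s + \<delta> n) y - u s y)"
      using integral_swap_2dim[of t1 a t2 b "\<lambda>s y. u (s + \<delta> n) y - u s y"] cs by (simp add: gs_def)
    have aux: "\<bar>real (Suc n) * X - Y\<bar> \<le> Z * \<delta> n" if "\<bar>X - \<delta> n * Y\<bar> \<le> Z * (\<delta> n)\<^sup>2" for X Y Z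
    proof -
      have "real (Suc n) * \<bar>X - \<delta> n * Y\<bar> \<le> real (Suc n) * (Z * (\<delta> n)\<^sup>2)"
        using that by (intro mult_left_mono) auto
      moreover have "real (Suc n) * \<bar>X - \<delta> n * Y\<bar> = \<bar>real (Suc n) * (X - \<delta> n * Y)\<bar>"
        by (simp add: abs_mult)
      moreover have "real (Suc n) * (X - \<delta> n * Y) = real (Suc n) * X - (real (Suc n) * \<delta> n) * Y"
        by (simp only: right_diff_distrib mult.assoc)
      moreover have "real (Suc n) * (Z * (\<delta> n)\<^sup>2) = (real (Suc n) * \<delta> n) * (Z * \<delta> n)"
        by (simp add: power2_eq_square)
      ultimately show ?thesis by (simp only: d(2) mult_1)
    qed
    have "\<bar>?i (gs n) - \<delta> n * integral {a..b} (\<lambda>y. u t2 y - u t1 y)\<bar> \<le> 2 * L * (\<delta> n)\<^sup>2 * (b - a)"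
      unfolding sw by (rule integral_box_shift_difference_approx[of "\<lambda>y s. u s y" L "\<delta> n" t1 t2 a b, OF lip' less_imp_le[OF d(1)] t ab])
    also have "\<dots> = 2 * L * (b - a) * (\<delta> n)\<^sup>2" by simp
    finally have 1: "\<bar>real (Suc n) * ?i (gs n) - integral {a..b} (\<lambda>y. u t2 y - u t1 y)\<bar> \<le> 2 * L * (b - a) * \<delta> n"
      by (rule aux)
    have 2: "\<bar>real (Suc n) * ?i (gy n) - integral {t1..t2} (\<lambda>s. u s b - u s a)\<bar> \<le> 2 * L * (t2 - t1) * \<delta> n"
      using integral_box_shift_difference_approx[OF lip, of "\<delta> n" a b t1 t2] d(1)[of n] t ab
      by (intro aux) (simp add: algebra_simps gy_def)
    have mult_abs_le: "v * X \<le> \<bar>v\<bar> * Z" if "\<bar>X\<bar> \<le> Z" for v X Z :: real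
    proof -
      have "v * X \<le> \<bar>v\<bar> * \<bar>X\<bar>" by (metis abs_ge_self abs_mult)
      also have "\<dots> \<le> \<bar>v\<bar> * Z" using that by (intro mult_left_mono) auto
      finally show ?thesis .
    qed
    show ?thesis using mult_abs_le[OF 1, of k] mult_abs_le[OF 2, of c] unfolding eq I_def C_def by (simp add: algebra_simps)
  qed
  have "\<delta> = (\<lambda>n. inverse (real (Suc n)))" by (auto simp: \<delta>_def fun_eq_iff field_simps)
  hence "\<delta> \<longlonglongrightarrow> 0" using LIMSEQ_inverse_real_of_nat by metis
  hence "(\<lambda>n. I + C * \<delta> n) \<longlonglongrightarrow> I + C * 0" by (intro tendsto_intros)
  with lim0 have "(LINT z:R|lborel. 0) \<le> I + C * 0"
    by (rule LIMSEQ_le) (use order_trans[OF ge le] in blast)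
  thus ?thesis by (simp add: I_def set_lebesgue_integral_def)
qed

text \<open>The derivative in the direction \<open>(1, - c)\<close> is at least \<open>l\<close>
  almost everywhere, but the line itself is a null set. Hence a window of width
  \<open>\<epsilon>\<close> is carried along it in \<open>n\<close> time steps. A step of length
  \<open>h\<close> errs by at most \<open>C * h\<^sup>2\<close>, so the total error is of order
  \<open>1 / n\<close>. Once \<open>n\<close> has gone to infinity, dividing by
  \<open>\<epsilon>\<close> and letting it tend to 0 gives the pointwise claim.\<close>

lemma integrated_inequality_along_line:
  fixes u :: "real \<Rightarrow> real \<Rightarrow> real"
  assumes lip: "\<And>s y s' y'. \<bar>u s y - u s' y'\<bar> \<le> L * (\<bar>s - s'\<bar> + \<bar>y - y'\<bar>)"
    and t: "t1 \<le> t2" and c: "c \<ge> 0" and S: "A < S - c * (t2 - t1)" "S < B"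
    and ae: "AE (s, y) in lborel. t1 < s \<and> s < t2 \<and> A < y \<and> y < B \<longrightarrow>
        (\<exists>p q. ((\<lambda>r. u r y) has_real_derivative p) (at s) \<and>
               ((\<lambda>x. u s x) has_real_derivative q) (at y) \<and> l \<le> p - c * q)"
  shows "l * (t2 - t1) \<le> u t2 (S - c * (t2 - t1)) - u t1 S"
proof -
  note cont = continuous_on_compose_pair_if_abs_diff_le[OF lip]
  have L0: "0 \<le> L" using lip[of 0 0 1 0] by (auto intro: order_trans[OF abs_ge_zero])
  have lip2: "\<bar>u s y - u s y'\<bar> \<le> L * \<bar>y - y'\<bar>" for s y y' using lip[of s y s y'] by simp
  have io: "(\<lambda>y. u s y) integrable_on {a..b}" for s a b
    by (intro integrable_continuous_interval cont continuous_intros)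
  define \<tau> where "\<tau> = t2 - t1"
  \<comment> \<open>The first summand pays for freezing the time in the flux through the sides of
    the box, the second for the shift of the window by \<open>c * h\<close>.\<close>
  define C where "C = 2 * c * L + 2 * L * c\<^sup>2"
  \<comment> \<open>Up to second order in \<open>h\<close>, the flux through the sides cancels
    against the displacement of the window.\<close>
  have step: "l * h * \<epsilon> - C * h\<^sup>2 \<le> integral {x-c*h..x-c*h+\<epsilon>} (u (s+h)) - integral {x..x+\<epsilon>} (u s)"
    if h: "h \<ge> 0" and s: "t1 \<le> s" "s + h \<le> t2" and x: "A \<le> x - c * h" "x - c * h + \<epsilon> \<le> B" and e: "\<epsilon> \<ge> 0"
    for h s x \<epsilon>
  proof -
    define a where "a = x - c * h"
    have ch: "c * h \<ge> 0" using c h by simp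
    have ae': "AE (s', y) in lborel. s < s' \<and> s' < s + h \<and> a < y \<and> y < a + \<epsilon> \<longrightarrow>
        (\<exists>p q. ((\<lambda>r. u r y) has_real_derivative p) (at s') \<and>
               ((\<lambda>x. u s' x) has_real_derivative q) (at y) \<and> l \<le> 1 * p + (- c) * q)"
      using ae by eventually_elim (use s x in \<open>auto simp: a_def\<close>)
    have 1: "l * (s + h - s) * (a + \<epsilon> - a) \<le> 1 * integral {a..a+\<epsilon>} (\<lambda>y. u (s+h) y - u s y)
        + (- c) * integral {s..s+h} (\<lambda>r. u r (a+\<epsilon>) - u r a)"
      by (rule integrated_differential_inequality[OF lip _ _ ae']) (use h e in auto)
    have "\<bar>integral {s..s+h} (\<lambda>r. u r (a+\<epsilon>) - u r a) - h * (u s (a+\<epsilon>) - u s a)\<bar> \<le> (2 * L) * h\<^sup>2"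
    proof (rule integral_initial_segment_approx)
      fix r r' show "\<bar>u r (a+\<epsilon>) - u r a - (u r' (a+\<epsilon>) - u r' a)\<bar> \<le> 2 * L * \<bar>r - r'\<bar>"
        using lip[of r "a+\<epsilon>" r' "a+\<epsilon>"] lip[of r a r' a] by simp
    qed (use h in auto)
    hence "h * (u s (a+\<epsilon>) - u s a) - (2 * L) * h\<^sup>2 \<le> integral {s..s+h} (\<lambda>r. u r (a+\<epsilon>) - u r a)"
      by (simp add: abs_le_iff)
    hence 2: "c * (h * (u s (a+\<epsilon>) - u s a) - (2 * L) * h\<^sup>2) \<le> c * integral {s..s+h} (\<lambda>r. u r (a+\<epsilon>) - u r a)"
      using c by (rule mult_left_mono)
    have 3: "\<bar>integral {a..a+\<epsilon>} (\<lambda>y. u s (y + c*h) - u s y) - c*h * (u s (a+\<epsilon>) - u s a)\<bar> \<le> 2 * L * (c*h)\<^sup>2"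
      using e ch by (intro integral_shift_difference_approx lip2) auto
    have sh: "((\<lambda>y. u s (y + c*h)) has_integral integral {x..x+\<epsilon>} (u s)) {a..a+\<epsilon>}"
      using has_integral_shift_cbox[of "u s" "integral {x..x+\<epsilon>} (u s)" x "x+\<epsilon>" "c*h"]
        integrable_integral[OF io[of s x "x+\<epsilon>"]] by (simp add: a_def algebra_simps)
    have 4: "integral {a..a+\<epsilon>} (\<lambda>y. u s (y + c*h) - u s y) = integral {x..x+\<epsilon>} (u s) - integral {a..a+\<epsilon>} (u s)"
      by (intro integral_unique has_integral_diff sh integrable_integral io)
    have 5: "integral {a..a+\<epsilon>} (\<lambda>y. u (s+h) y - u s y) = integral {a..a+\<epsilon>} (u (s+h)) - integral {a..a+\<epsilon>} (u s)"
      by (intro integral_diff io)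
    have 6: "(c*h)\<^sup>2 = c\<^sup>2 * h\<^sup>2" by (simp add: power_mult_distrib)
    show ?thesis using 1 2 3 unfolding 4 5 a_def[symmetric] C_def abs_le_iff 6 by (simp add: algebra_simps)
  qed
  have main: "l * \<tau> \<le> u t2 (S - c * \<tau>) - u t1 S + 2 * L * \<epsilon>" if e: "\<epsilon> > 0" "S + \<epsilon> < B" for \<epsilon>
  proof -
    have tau: "0 \<le> \<tau>" using t by (simp add: \<tau>_def)
    have part: "l * \<tau> * \<epsilon> - C * \<tau>\<^sup>2 / real n
        \<le> integral {S-c*\<tau>..S-c*\<tau>+\<epsilon>} (u t2) - integral {S..S+\<epsilon>} (u t1)" if n: "n > 0" for n
    proof -
      define h where "h = \<tau> / real n"
      have h: "h \<ge> 0" "real n * h = \<tau>" using tau n by (auto simp: h_def)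
      define I where "I i = integral {S - c * (real i * h)..S - c * (real i * h) + \<epsilon>} (u (t1 + real i * h))" for i
      have "real i * (l * h * \<epsilon> - C * h\<^sup>2) \<le> I i - I 0" if "i \<le> n" for i
        using that
      proof (induction i)
        case (Suc i)
        have "real (Suc i) * h \<le> real n * h" using Suc.prems h(1) by (intro mult_right_mono) auto
        hence ih: "real i * h + h \<le> \<tau>" by (simp add: h(2)[symmetric] algebra_simps)
        have "c * (real i * h + h) \<le> c * \<tau>" using ih c by (rule mult_left_mono)
        hence x: "A \<le> S - c * (real i * h) - c * h" using S(1) by (simp add: algebra_simps \<tau>_def)
        have x': "S - c * (real i * h) - c * h + \<epsilon> \<le> B"
        proof -
          have "0 \<le> c * (real i * h)" "0 \<le> c * h" using c h(1) by auto
          thus ?thesis using e(2) by linarith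
        qed
        have "l * h * \<epsilon> - C * h\<^sup>2 \<le> I (Suc i) - I i"
          using step[OF h(1), of "t1 + real i * h" "S - c * (real i * h)" \<epsilon>] ih h(1) x x' e(1)
          by (simp add: I_def \<tau>_def algebra_simps)
        thus ?case using Suc.IH Suc.prems by (simp add: algebra_simps)
      qed (simp add: I_def)
      from this[of n] have "real n * (l * h * \<epsilon> - C * h\<^sup>2)
          \<le> integral {S-c*\<tau>..S-c*\<tau>+\<epsilon>} (u t2) - integral {S..S+\<epsilon>} (u t1)"
        by (simp add: I_def h(2)) (simp add: \<tau>_def)
      moreover have "real n * (l * h * \<epsilon> - C * h\<^sup>2) = l * \<tau> * \<epsilon> - C * \<tau>\<^sup>2 / real n"
        using n by (simp add: h_def field_simps power2_eq_square)
      ultimately show ?thesis by simp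
    qed
    have "(\<lambda>n. l * \<tau> * \<epsilon> - C * \<tau>\<^sup>2 / real n) \<longlonglongrightarrow> l * \<tau> * \<epsilon> - 0"
      by (intro tendsto_intros lim_const_over_n)
    hence "l * \<tau> * \<epsilon> - 0 \<le> integral {S-c*\<tau>..S-c*\<tau>+\<epsilon>} (u t2) - integral {S..S+\<epsilon>} (u t1)"
      by (rule LIMSEQ_le_const2) (use part in \<open>auto intro!: exI[of _ 1]\<close>)
    moreover have "\<bar>integral {S-c*\<tau>..S-c*\<tau>+\<epsilon>} (u t2) - \<epsilon> * u t2 (S-c*\<tau>)\<bar> \<le> L * \<epsilon>\<^sup>2"
      "\<bar>integral {S..S+\<epsilon>} (u t1) - \<epsilon> * u t1 S\<bar> \<le> L * \<epsilon>\<^sup>2"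
      using e(1) by (intro integral_initial_segment_approx lip2; simp)+
    ultimately have "\<epsilon> * (l * \<tau>) \<le> \<epsilon> * (u t2 (S - c * \<tau>) - u t1 S + 2 * L * \<epsilon>)"
      unfolding abs_le_iff by (simp add: algebra_simps power2_eq_square)
    thus ?thesis using e(1) by simp
  qed
  have "((\<lambda>\<epsilon>. u t2 (S - c * \<tau>) - u t1 S + 2 * L * \<epsilon>) \<longlongrightarrow> u t2 (S - c * \<tau>) - u t1 S + 2 * L * 0) (at_right 0)"
    by (intro tendsto_intros)
  moreover have "eventually (\<lambda>\<epsilon>. l * \<tau> \<le> u t2 (S - c * \<tau>) - u t1 S + 2 * L * \<epsilon>) (at_right 0)"
    using eventually_at_right_real[of 0 "B - S"] S(2) by (auto elim!: eventually_mono intro: main)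
  ultimately have "l * \<tau> \<le> u t2 (S - c * \<tau>) - u t1 S + 2 * L * 0"
    by (intro tendsto_lowerbound) auto
  thus ?thesis by (simp add: \<tau>_def)
qed

section \<open>Localisation to boxes\<close>

lemma locally_lipschitz_on_strip_imp_box_lipschitz:
  fixes w :: "real \<Rightarrow> real \<Rightarrow> real"
  assumes "locally_lipschitz_on ({0..T} \<times> UNIV) (\<lambda>(t, S). w t S)"
  obtains L where "\<And>s y s' y'. s \<in> {0..T} \<Longrightarrow> s' \<in> {0..T} \<Longrightarrow> y \<in> {-R..R} \<Longrightarrow> y' \<in> {-R..R} \<Longrightarrow>
      \<bar>w s y - w s' y'\<bar> \<le> L * (\<bar>s - s'\<bar> + \<bar>y - y'\<bar>)"
proof -
  let ?g = "\<lambda>(t, S). w t S" and ?X = "{0..T} \<times> {-R..R}"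
  \<comment> \<open>The notion of \<open>local_lipschitz\<close> carries a parameter set;
    \<open>{0}\<close> is a dummy for it.\<close>
  have loc: "local_lipschitz {0::real} ?X (\<lambda>_. ?g)"
    unfolding local_lipschitz_def
  proof (intro ballI)
    fix z assume "z \<in> ?X"
    then obtain u L where "u > 0" "L-lipschitz_on (cball z u \<inter> {0..T} \<times> UNIV) ?g"
      using assms unfolding locally_lipschitz_on_def by blast
    moreover have "cball z u \<inter> ?X \<subseteq> cball z u \<inter> {0..T} \<times> UNIV" by auto
    ultimately show "\<exists>u>0. \<exists>L. \<forall>t\<in>cball t u \<inter> {0}. L-lipschitz_on (cball z u \<inter> ?X) ?g" for t :: real
      by (meson lipschitz_on_subset)
  qed
  obtain L where L: "L-lipschitz_on ?X ?g"
    by (rule local_lipschitz_compact_implies_lipschitz[OF loc]) (auto intro!: compact_Times)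
  have "\<bar>w s y - w s' y'\<bar> \<le> L * (\<bar>s - s'\<bar> + \<bar>y - y'\<bar>)"
    if "s \<in> {0..T}" "s' \<in> {0..T}" "y \<in> {-R..R}" "y' \<in> {-R..R}" for s y s' y'
  proof -
    have "dist (w s y) (w s' y') \<le> L * dist (s, y) (s', y')"
      using lipschitz_onD[OF L, of "(s, y)" "(s', y')"] that by auto
    also have "\<dots> \<le> L * (\<bar>s - s'\<bar> + \<bar>y - y'\<bar>)"
      using lipschitz_on_nonneg[OF L]
      by (intro mult_left_mono) (auto simp: dist_Pair_Pair dist_real_def sqrt_sum_squares_le_sum_abs)
    finally show ?thesis by (simp add: dist_real_def)
  qed
  thus ?thesis using that by blast
qed

definition clamp_interval :: "real \<Rightarrow> real \<Rightarrow> real \<Rightarrow> real" where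
  "clamp_interval a b x = max a (min b x)"

lemma clamp_interval_id: "a \<le> x \<Longrightarrow> x \<le> b \<Longrightarrow> clamp_interval a b x = x"
  by (simp add: clamp_interval_def)

lemma clamp_interval_mem: "a \<le> b \<Longrightarrow> clamp_interval a b x \<in> {a..b}"
  by (simp add: clamp_interval_def)

lemma clamp_interval_lipschitz: "\<bar>clamp_interval a b x - clamp_interval a b y\<bar> \<le> \<bar>x - y\<bar>"
  by (simp add: clamp_interval_def)

text \<open>The integral estimates shift points in both coordinates and so leave the strip.
  Composing with the projection onto a box gives a globally Lipschitz function. Derivatives survive
  only in the open box, which is all that an almost everywhere statement has to offer.\<close>

lemma strip_extension:
  fixes w :: "real \<Rightarrow> real \<Rightarrow> real"
  assumes ll: "locally_lipschitz_on ({0..T} \<times> UNIV) (\<lambda>(t, S). w t S)" and T: "T > 0" and R: "R > 0"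
  obtains u L where "L \<ge> 0"
    "\<And>s y s' y'. \<bar>u s y - u s' y'\<bar> \<le> L * (\<bar>s - s'\<bar> + \<bar>y - y'\<bar>)"
    "\<And>s y. 0 \<le> s \<Longrightarrow> s \<le> T \<Longrightarrow> -R \<le> y \<Longrightarrow> y \<le> R \<Longrightarrow> u s y = w s y"
    "\<And>s y p. 0 < s \<Longrightarrow> s < T \<Longrightarrow> -R < y \<Longrightarrow> y < R \<Longrightarrow>
       ((\<lambda>r. w r y) has_real_derivative p) (at s) \<Longrightarrow> ((\<lambda>r. u r y) has_real_derivative p) (at s)"
    "\<And>s y q. 0 < s \<Longrightarrow> s < T \<Longrightarrow> -R < y \<Longrightarrow> y < R \<Longrightarrow>
       ((\<lambda>x. w s x) has_real_derivative q) (at y) \<Longrightarrow> ((\<lambda>x. u s x) has_real_derivative q) (at y)"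
proof -
  obtain L where L: "\<And>s y s' y'. s \<in> {0..T} \<Longrightarrow> s' \<in> {0..T} \<Longrightarrow> y \<in> {-R..R} \<Longrightarrow> y' \<in> {-R..R} \<Longrightarrow>
      \<bar>w s y - w s' y'\<bar> \<le> L * (\<bar>s - s'\<bar> + \<bar>y - y'\<bar>)"
    using locally_lipschitz_on_strip_imp_box_lipschitz[OF ll] by metis
  define u where "u s y = w (clamp_interval 0 T s) (clamp_interval (-R) R y)" for s y
  have L0: "0 \<le> L" using order_trans[OF abs_ge_zero L[of 0 T 0 0]] T R by (simp add: zero_le_mult_iff)
  show ?thesis
  proof (rule that[of L u])
    fix s y s' y'
    have "\<bar>u s y - u s' y'\<bar> \<le> L * (\<bar>clamp_interval 0 T s - clamp_interval 0 T s'\<bar>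
        + \<bar>clamp_interval (-R) R y - clamp_interval (-R) R y'\<bar>)"
      unfolding u_def using T R by (intro L clamp_interval_mem) auto
    also have "\<dots> \<le> L * (\<bar>s - s'\<bar> + \<bar>y - y'\<bar>)"
      using L0 by (intro mult_left_mono add_mono clamp_interval_lipschitz)
    finally show "\<bar>u s y - u s' y'\<bar> \<le> L * (\<bar>s - s'\<bar> + \<bar>y - y'\<bar>)" .
  next
    fix s y p assume *: "0 < s" "s < T" "-R < y" "y < R" "((\<lambda>r. w r y) has_real_derivative p) (at s)"
    show "((\<lambda>r. u r y) has_real_derivative p) (at s)"
      by (rule has_field_derivative_transform_within_open[OF *(5), of "{0<..<T}"])
         (use * in \<open>auto simp: u_def clamp_interval_id\<close>)
  next
    fix s y q assume *: "0 < s" "s < T" "-R < y" "y < R" "((\<lambda>x. w s x) has_real_derivative q) (at y)"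
    show "((\<lambda>x. u s x) has_real_derivative q) (at y)"
      by (rule has_field_derivative_transform_within_open[OF *(5), of "{-R<..<R}"])
         (use * in \<open>auto simp: u_def clamp_interval_id\<close>)
  qed (use L0 in \<open>auto simp: u_def clamp_interval_id\<close>)
qed

text \<open>With \<open>l + c * q \<le> H q\<close>, the equation makes the derivative in the
  direction \<open>(1, - c)\<close> at least \<open>l\<close>. The box of half-width
  \<open>R\<close> is chosen to contain the whole segment from \<open>S\<close> to
  \<open>S - c * (T - t)\<close> in its interior.\<close>

lemma almost_everywhere_solution_le_characteristic:
  fixes w :: "real \<Rightarrow> real \<Rightarrow> real"
  assumes ll: "locally_lipschitz_on ({0..T} \<times> UNIV) (\<lambda>(t, S). w t S)" and T: "T > 0"
    and ae: "AE (t, S) in lborel. 0 < t \<and> t < T \<longrightarrow>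
        (\<exists>q. ((\<lambda>r. w r S) has_real_derivative H q) (at t) \<and> ((\<lambda>x. w t x) has_real_derivative q) (at S))"
    and H: "\<And>q. l + c * q \<le> H q" and c: "c \<ge> 0" and t: "0 \<le> t" "t \<le> T"
  shows "w t S + l * (T - t) \<le> w T (S - c * (T - t))"
proof -
  define R where "R = \<bar>S\<bar> + c * (T - t) + 1"
  have ct: "c * (T - t) \<ge> 0" using c t by simp
  have R: "R > 0" "-R < S - c * (T - t)" "S < R" using ct by (auto simp: R_def)
  obtain u L where u: "L \<ge> 0"
    "\<And>s y s' y'. \<bar>u s y - u s' y'\<bar> \<le> L * (\<bar>s - s'\<bar> + \<bar>y - y'\<bar>)"
    "\<And>s y. 0 \<le> s \<Longrightarrow> s \<le> T \<Longrightarrow> -R \<le> y \<Longrightarrow> y \<le> R \<Longrightarrow> u s y = w s y"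
    "\<And>s y p. 0 < s \<Longrightarrow> s < T \<Longrightarrow> -R < y \<Longrightarrow> y < R \<Longrightarrow>
       ((\<lambda>r. w r y) has_real_derivative p) (at s) \<Longrightarrow> ((\<lambda>r. u r y) has_real_derivative p) (at s)"
    "\<And>s y q. 0 < s \<Longrightarrow> s < T \<Longrightarrow> -R < y \<Longrightarrow> y < R \<Longrightarrow>
       ((\<lambda>x. w s x) has_real_derivative q) (at y) \<Longrightarrow> ((\<lambda>x. u s x) has_real_derivative q) (at y)"
    by (rule strip_extension[OF ll T R(1)]) blast
  have "l * (T - t) \<le> u T (S - c * (T - t)) - u t S"
  proof (rule integrated_inequality_along_line[OF u(2) t(2) c R(2,3)])
    show "AE (s, y) in lborel. t < s \<and> s < T \<and> - R < y \<and> y < R \<longrightarrow>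
        (\<exists>p q. ((\<lambda>r. u r y) has_real_derivative p) (at s) \<and>
               ((\<lambda>x. u s x) has_real_derivative q) (at y) \<and> l \<le> p - c * q)"
      using ae
    proof eventually_elim
      case (elim z)
      show ?case
      proof (clarify, goal_cases)
        case (1 s y)
        with elim t obtain q where "((\<lambda>r. w r y) has_real_derivative H q) (at s)"
            "((\<lambda>x. w s x) has_real_derivative q) (at y)" by auto
        with 1 t show ?case using H[of q] u(4)[of s y "H q"] u(5)[of s y q]
          by (intro exI[of _ "H q"] exI[of _ q]) auto
      qed
    qed
  qed
  moreover have "u T (S - c * (T - t)) = w T (S - c * (T - t))" "u t S = w t S"
    using t T R ct by (auto intro!: u(3))
  ultimately show ?thesis by simp
qed

section \<open>Comparison with affine solutions\<close>

text \<open>Dyadic halving: \<open>E n\<close> is the backward difference of step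
  \<open>\<kappa> / 2 ^ n\<close>, rescaled to length \<open>\<kappa>\<close>. Semi-concavity at the
  midpoint bounds the increase from \<open>E n\<close> to \<open>E (Suc n)\<close>, and these bounds
  form a geometric series with sum \<open>C / 2 * \<kappa>\<^sup>2\<close>. The limit of
  \<open>E\<close> is \<open>\<kappa> * p\<close>.\<close>

lemma semiconcave_derivative_le_backward_difference:
  fixes g :: "real \<Rightarrow> real"
  assumes sc: "\<And>y z. g (y + z) - 2 * g y + g (y - z) \<le> C * z\<^sup>2"
    and der: "(g has_real_derivative p) (at y)" and k: "\<kappa> > 0"
  shows "p * \<kappa> \<le> g y - g (y - \<kappa>) + C / 2 * \<kappa>\<^sup>2"
proof -
  define E where "E n = 2 ^ n * (g y - g (y - \<kappa> / 2 ^ n))" for n :: nat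
  have E_le: "E n \<le> g y - g (y - \<kappa>) + C / 2 * \<kappa>\<^sup>2 * (1 - 1 / 2 ^ n)" for n
  proof (induction n)
    case (Suc n)
    define h where "h = \<kappa> / 2 ^ Suc n"
    have h2: "\<kappa> / 2 ^ n = 2 * h" by (simp add: h_def)
    have "g (y - h + h) - 2 * g (y - h) + g (y - h - h) \<le> C * h\<^sup>2" by (rule sc)
    hence "2 * (g y - g (y - h)) \<le> g y - g (y - 2 * h) + C * h\<^sup>2" by (simp add: algebra_simps)
    hence "2 ^ n * (2 * (g y - g (y - h))) \<le> 2 ^ n * (g y - g (y - 2 * h) + C * h\<^sup>2)"
      by (rule mult_left_mono) simp
    hence "E (Suc n) \<le> E n + 2 ^ n * (C * h\<^sup>2)"
      unfolding E_def h_def[symmetric] h2 by (simp add: algebra_simps)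
    moreover have "2 ^ n * (C * h\<^sup>2) = C / 2 * \<kappa>\<^sup>2 * (1 / 2 ^ n - 1 / 2 ^ Suc n)"
      by (simp add: h_def field_simps power2_eq_square)
    ultimately have "E (Suc n) \<le> g y - g (y - \<kappa>) + C / 2 * \<kappa>\<^sup>2 * (1 - 1 / 2 ^ n)
        + C / 2 * \<kappa>\<^sup>2 * (1 / 2 ^ n - 1 / 2 ^ Suc n)"
      using Suc by linarith
    thus ?case by (simp only: right_diff_distrib)
  qed (simp add: E_def)
  have lim: "E \<longlonglongrightarrow> \<kappa> * p"
  proof -
    have "(\<lambda>h. (g (y + h) - g y) / h) \<midarrow>0\<rightarrow> p" using der by (simp add: DERIV_def)
    moreover have "filterlim (\<lambda>n. - \<kappa> / 2 ^ n) (at 0) sequentially"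
    proof (rule filterlim_atI)
      have "(\<lambda>n. (- \<kappa>) * (1 / 2) ^ n) \<longlonglongrightarrow> (- \<kappa>) * 0"
        by (intro tendsto_intros LIMSEQ_power_zero) auto
      thus "(\<lambda>n. - \<kappa> / 2 ^ n) \<longlonglongrightarrow> 0" by (simp add: power_divide)
    qed (use k in auto)
    ultimately have "(\<lambda>n. (g (y + - \<kappa> / 2 ^ n) - g y) / (- \<kappa> / 2 ^ n)) \<longlonglongrightarrow> p"
      by (rule filterlim_compose)
    hence "(\<lambda>n. \<kappa> * ((g (y + - \<kappa> / 2 ^ n) - g y) / (- \<kappa> / 2 ^ n))) \<longlonglongrightarrow> \<kappa> * p"
      by (intro tendsto_intros)
    also have "(\<lambda>n. \<kappa> * ((g (y + - \<kappa> / 2 ^ n) - g y) / (- \<kappa> / 2 ^ n))) = E"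
      using k by (auto simp: E_def fun_eq_iff field_simps)
    finally show ?thesis .
  qed
  have "(\<lambda>n. g y - g (y - \<kappa>) + C / 2 * \<kappa>\<^sup>2 * (1 - (1 / 2) ^ n)) \<longlonglongrightarrow> g y - g (y - \<kappa>) + C / 2 * \<kappa>\<^sup>2 * (1 - 0)"
    by (intro tendsto_intros LIMSEQ_power_zero) auto
  with lim have "\<kappa> * p \<le> g y - g (y - \<kappa>) + C / 2 * \<kappa>\<^sup>2 * (1 - 0)"
    using E_le by (intro LIMSEQ_le) (auto simp: power_divide)
  thus ?thesis by (simp add: mult.commute)
qed

text \<open>The contradiction is quantitative. At the minimum \<open>(t1, S1)\<close>,
  \<open>w\<close> must grow in time at rate at least \<open>H x + \<delta> + M * q\<close>, while
  the equation on a thin box next to that point allows at most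
  \<open>H x + M * (q + N * \<kappa>)\<close> plus small errors; hence \<open>\<delta>\<close> is
  bounded by a multiple of \<open>\<kappa>\<close>. The minimum is exploited only to the left and
  forward in time, so it may lie on \<open>t = t0\<close> or on \<open>S = S0\<close>.\<close>

lemma semiconcave_solution_ge_affine:
  fixes w :: "real \<Rightarrow> real \<Rightarrow> real"
  assumes ll: "locally_lipschitz_on ({0..T} \<times> UNIV) (\<lambda>(t, S). w t S)" and T: "T > 0"
    and ae: "AE (t, S) in lborel. 0 < t \<and> t < T \<longrightarrow>
        (\<exists>q. ((\<lambda>r. w r S) has_real_derivative H q) (at t) \<and> ((\<lambda>x. w t x) has_real_derivative q) (at S))"
    and sc: "\<And>t S z. 0 \<le> t \<Longrightarrow> t < T \<Longrightarrow>
        w t (S + z) - 2 * w t S + w t (S - z) \<le> C * (1 + 1 / (T - t)) * z\<^sup>2"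
    and C: "C \<ge> 0" and M: "M \<ge> 0"
    and H_mono: "\<And>x y. x \<le> y \<Longrightarrow> H x \<le> H y" and H_lip: "\<And>x y. x \<le> y \<Longrightarrow> H y \<le> H x + M * (y - x)"
    and terminal: "\<And>S. S * x - B \<le> w T S"
    and t0: "0 \<le> t0" "t0 \<le> T"
  shows "S0 * x - (T - t0) * H x - B \<le> w t0 S0"
proof (rule ccontr)
  define z where "z t S = w t S - (S * x - (T - t) * H x - B)" for t S
  assume "\<not> ?thesis"
  hence neg: "z t0 S0 < 0" by (simp add: z_def)
  have zT: "z T S \<ge> 0" for S using terminal[of S] by (simp add: z_def)
  have t0T: "t0 < T" using neg zT[of S0] t0 by (cases "t0 = T") auto
  \<comment> \<open>With this size the term \<open>\<delta> * (T - t)\<close> uses up half of the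
    negative value at \<open>(t0, S0)\<close>, and \<open>\<Phi> t0 S0\<close> stays
    negative.\<close>
  define \<delta> where "\<delta> = - z t0 S0 / (2 * (T - t0))"
  have \<delta>: "\<delta> > 0" "\<delta> * (T - t0) = - z t0 S0 / 2" using neg t0T by (auto simp: \<delta>_def field_simps)
  \<comment> \<open>One unit more than information can travel, so that \<open>pen\<close> is at
    least 1 on the whole left side of \<open>D\<close>.\<close>
  define r where "r = M * (T - t0) + 1"
  have Mt: "M * (T - t0) \<ge> 0" using M t0T by simp
  \<comment> \<open>The margin keeps the points used below, at most one unit to the left of
    \<open>D\<close>, inside the box.\<close>
  define R where "R = \<bar>S0\<bar> + r + 2"
  have R: "R > 0" using Mt by (simp add: R_def r_def)
  obtain u L where u: "L \<ge> 0"
    "\<And>s y s' y'. \<bar>u s y - u s' y'\<bar> \<le> L * (\<bar>s - s'\<bar> + \<bar>y - y'\<bar>)"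
    "\<And>s y. 0 \<le> s \<Longrightarrow> s \<le> T \<Longrightarrow> -R \<le> y \<Longrightarrow> y \<le> R \<Longrightarrow> u s y = w s y"
    "\<And>s y p. 0 < s \<Longrightarrow> s < T \<Longrightarrow> -R < y \<Longrightarrow> y < R \<Longrightarrow>
       ((\<lambda>r. w r y) has_real_derivative p) (at s) \<Longrightarrow> ((\<lambda>r. u r y) has_real_derivative p) (at s)"
    "\<And>s y q. 0 < s \<Longrightarrow> s < T \<Longrightarrow> -R < y \<Longrightarrow> y < R \<Longrightarrow>
       ((\<lambda>x. w s x) has_real_derivative q) (at y) \<Longrightarrow> ((\<lambda>x. u s x) has_real_derivative q) (at y)"
    by (rule strip_extension[OF ll T R]) blast
  note cont = continuous_on_compose_pair_if_abs_diff_le[OF u(2)]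
  define D where "D = {t0..T} \<times> {S0 - r..S0}"
  have D_box: "0 \<le> t" "t \<le> T" "-R + 1 \<le> S" "S \<le> R - 1" if "(t, S) \<in> D" for t S
    using that t0 Mt by (auto simp: D_def R_def r_def)
  have zu: "z t S = u t S - (S * x - (T - t) * H x - B)" if "(t, S) \<in> D" for t S
    using D_box[OF that] by (simp add: z_def u(3))
  have D: "compact D" "D \<noteq> {}" using t0T Mt by (auto simp: D_def r_def intro!: compact_Times)
  have cz: "continuous_on D (\<lambda>p. z (fst p) (snd p))"
  proof -
    have "continuous_on D (\<lambda>p. u (fst p) (snd p) - (snd p * x - (T - fst p) * H x - B))"
      by (intro continuous_intros cont)
    thus ?thesis by (rule continuous_on_eq) (auto simp: zu)
  qed
  obtain A0 where A0: "\<And>t S. (t, S) \<in> D \<Longrightarrow> - A0 \<le> z t S"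
  proof -
    obtain p where "p \<in> D" and p: "\<And>p'. p' \<in> D \<Longrightarrow> z (fst p) (snd p) \<le> z (fst p') (snd p')"
      using continuous_attains_inf[OF D cz] by auto
    show ?thesis
    proof (rule that)
      fix t S assume "(t, S) \<in> D"
      from p[OF this] show "- (- z (fst p) (snd p)) \<le> z t S" by simp
    qed
  qed
  \<comment> \<open>This weight makes \<open>\<Phi>\<close> nonnegative wherever the penalty
    function \<open>pen\<close> is at least 1, because \<open>z\<close> is at least
    \<open>- A\<close> on \<open>D\<close>.\<close>
  define A where "A = max A0 0"
  have A: "A \<ge> 0" "\<And>t S. (t, S) \<in> D \<Longrightarrow> - A \<le> z t S" using A0 by (force simp: A_def)+
  \<comment> \<open>The penalty confines the minimum to the backward cone of dependence of \<open>(t0, S0)\<close>: since the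
      Hamiltonian is nondecreasing and M-Lipschitz, information only travels from the left, at speed at most M.\<close>
  define pen where "pen t S = max 0 (S0 - S - M * (t - t0))" for t S
  define \<Phi> where "\<Phi> t S = z t S + \<delta> * (T - t) + A * (pen t S)\<^sup>2" for t S
  have "continuous_on D (\<lambda>p. \<Phi> (fst p) (snd p))"
    unfolding \<Phi>_def pen_def by (intro continuous_intros cz)
  from continuous_attains_inf[OF D this]
  obtain t1 S1 where 1: "(t1, S1) \<in> D" and min: "\<And>t S. (t, S) \<in> D \<Longrightarrow> \<Phi> t1 S1 \<le> \<Phi> t S"
    by (metis (no_types, lifting) fst_conv prod.collapse snd_conv)
  have "\<Phi> t1 S1 \<le> \<Phi> t0 S0" using t0T Mt by (intro min) (auto simp: D_def r_def)
  also have "\<Phi> t0 S0 < 0" using \<delta> neg by (simp add: \<Phi>_def pen_def)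
  finally have \<Phi>neg: "\<Phi> t1 S1 < 0" .
  have t1: "t0 \<le> t1" "t1 < T"
  proof -
    show "t0 \<le> t1" using 1 by (simp add: D_def)
    have "\<Phi> T S1 \<ge> 0" using zT[of S1] A(1) by (simp add: \<Phi>_def)
    with \<Phi>neg have "t1 \<noteq> T" by auto
    thus "t1 < T" using 1 by (simp add: D_def)
  qed
  have S1: "S0 - r < S1" "S1 \<le> S0"
  proof -
    show "S1 \<le> S0" using 1 by (simp add: D_def)
    have "S1 \<noteq> S0 - r"
    proof
      assume S1: "S1 = S0 - r"
      have "M * (t1 - t0) \<le> M * (T - t0)" using M t1 by (intro mult_left_mono) auto
      hence "pen t1 S1 \<ge> 1" by (simp add: pen_def S1 r_def)
      hence "A * 1 \<le> A * (pen t1 S1)\<^sup>2" using A(1) by (intro mult_left_mono) auto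
      moreover have "\<delta> * (T - t1) \<ge> 0" using \<delta> t1 by simp
      ultimately show False using A(2)[OF 1] \<Phi>neg by (simp add: \<Phi>_def)
    qed
    thus "S0 - r < S1" using 1 by (simp add: D_def)
  qed
  define P where "P = pen t1 S1"
  \<comment> \<open>Minus the S-derivative of \<open>A * (pen t S)\<^sup>2\<close> at the minimum:
    the slope of \<open>w\<close> to the left is pushed from \<open>x\<close> to at most about
    \<open>x + q\<close>. Since the penalty moves with speed \<open>M\<close>, it also adds
    \<open>M * q\<close> to the growth in time, which pays exactly for the Lipschitz bound on
    \<open>H (x + q) - H x\<close>.\<close>
  define q where "q = 2 * A * P"
  have P: "P \<ge> 0" "q \<ge> 0" using A(1) by (auto simp: P_def pen_def q_def)
  have touch_left: "u t1 S1 - u t1 (S1 - \<kappa>) \<le> (x + q) * \<kappa> + A * \<kappa>\<^sup>2"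
    if k: "0 < \<kappa>" "S0 - r \<le> S1 - \<kappa>" for \<kappa>
  proof -
    have D': "(t1, S1 - \<kappa>) \<in> D" using k S1 t1 by (auto simp: D_def)
    have "pen t1 (S1 - \<kappa>) \<le> P + \<kappa>" "0 \<le> pen t1 (S1 - \<kappa>)" using k by (auto simp: P_def pen_def)
    hence "A * (pen t1 (S1 - \<kappa>))\<^sup>2 \<le> A * (P + \<kappa>)\<^sup>2" using A(1) by (intro mult_left_mono power_mono)
    with min[OF D'] have "z t1 S1 + A * P\<^sup>2 \<le> z t1 (S1 - \<kappa>) + A * (P + \<kappa>)\<^sup>2"
      by (simp add: \<Phi>_def P_def)
    thus ?thesis unfolding zu[OF 1] zu[OF D'] by (simp add: q_def algebra_simps power2_eq_square)
  qed
  have touch_time: "h * (H x + \<delta> + M * q) - A * M\<^sup>2 * h\<^sup>2 \<le> u (t1 + h) S1 - u t1 S1"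
    if h: "0 < h" "t1 + h \<le> T" for h
  proof -
    have D': "(t1 + h, S1) \<in> D" using h S1 t1 by (auto simp: D_def)
    have "(pen (t1 + h) S1)\<^sup>2 \<le> (P - M * h)\<^sup>2"
    proof (cases "S0 - S1 - M * (t1 + h - t0) \<le> 0")
      case False
      have "M * h \<ge> 0" using M h by simp
      with False have "pen (t1 + h) S1 = P - M * h" by (simp add: P_def pen_def algebra_simps)
      thus ?thesis by simp
    qed (simp add: pen_def)
    hence "A * (pen (t1 + h) S1)\<^sup>2 \<le> A * (P - M * h)\<^sup>2" using A(1) by (rule mult_left_mono)
    with min[OF D'] have "z t1 S1 + \<delta> * (T - t1) + A * P\<^sup>2 \<le> z (t1 + h) S1 + \<delta> * (T - (t1 + h)) + A * (P - M * h)\<^sup>2"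
      by (simp add: \<Phi>_def P_def)
    thus ?thesis unfolding zu[OF 1] zu[OF D'] by (simp add: q_def algebra_simps power2_eq_square)
  qed
  \<comment> \<open>For times \<open>s\<close> with \<open>s - t1 \<le> (T - t1) / 2\<close> this
    dominates the semi-concavity constant, which may blow up only at \<open>T\<close>. In
    \<open>N\<close>, the three summands come from the penalty, from semi-concavity, and from moving
    the touching point by \<open>h + \<eta>\<close>.\<close>
  define C' where "C' = C * (1 + 2 / (T - t1))"
  define N where "N = A + C' / 2 + 4 * L"
  have C': "C' \<ge> 0" "N \<ge> 0" using C t1 A(1) u(1) by (auto simp: C'_def N_def)
  have key: "\<delta> \<le> (A * M\<^sup>2 + M * N + 2 * L) * \<kappa>"
    if k: "0 < \<kappa>" "\<kappa> < 1" "\<kappa>\<^sup>2 < (T - t1) / 2" "\<kappa> < S1 - (S0 - r)" for \<kappa>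
  proof -
    \<comment> \<open>The scales are \<open>\<kappa>\<close> for the slope, its square for the
      duration and its cube for the width of the box. Moving the touching point then costs order
      \<open>\<kappa>\<^sup>2\<close> in a difference that is divided by \<open>\<kappa>\<close>,
      and replacing the average over the width by a point value costs order \<open>\<eta>\<close>,
      which is small compared with \<open>h\<close>.\<close>
    define h where "h = \<kappa>\<^sup>2"
    define \<eta> where "\<eta> = h * \<kappa>"
    have h: "0 < h" "t1 + h < T" "h \<le> (T - t1) / 2" "h \<le> 1" using k t1
      by (auto simp: h_def power_le_one less_imp_le)
    have \<eta>h: "0 < \<eta>" "\<eta> \<le> h"
      using h k mult_left_mono[of \<kappa> 1 h] by (auto simp: \<eta>_def)
    hence \<eta>: "0 < \<eta>" "\<eta> \<le> h" "\<eta> \<le> 1" using h by auto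
    define b where "b = H x + M * (q + N * \<kappa>)"
    have slope: "H p \<le> b"
      if s: "t1 < s" "s < t1 + h" and y: "S1 - \<eta> < y" "y < S1"
        and p: "((\<lambda>x. w s x) has_real_derivative p) (at y)" for s y p
    proof -
      have sT: "0 \<le> s" "s < T" "0 < s" using s h t1 t0 by auto
      have "1 / (T - s) \<le> 2 / (T - t1)" using s h sT by (simp add: field_simps)
      hence "C * (1 + 1 / (T - s)) \<le> C'" unfolding C'_def using C by (intro mult_left_mono) auto
      hence "C * (1 + 1 / (T - s)) * v\<^sup>2 \<le> C' * v\<^sup>2" for v by (rule mult_right_mono) auto
      hence "w s (y' + v) - 2 * w s y' + w s (y' - v) \<le> C' * v\<^sup>2" for y' v
        using sc[OF sT(1,2), of y' v] order_trans by blast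
      from semiconcave_derivative_le_backward_difference[OF this p k(1)]
      have "p * \<kappa> \<le> w s y - w s (y - \<kappa>) + C' / 2 * \<kappa>\<^sup>2" by simp
      also have "w s y - w s (y - \<kappa>) = u s y - u s (y - \<kappa>)"
      proof -
        have Dk: "(t1, S1 - \<kappa>) \<in> D" using k S1 t1 by (auto simp: D_def)
        show ?thesis using sT y k \<eta> D_box[OF 1] D_box[OF Dk] by (simp add: u(3))
      qed
      also have "\<dots> \<le> u t1 S1 - u t1 (S1 - \<kappa>) + 2 * L * (h + \<eta>)"
      proof -
        have "L * (\<bar>s - t1\<bar> + \<bar>y - S1\<bar>) \<le> L * (h + \<eta>)"
          using s y u(1) by (intro mult_left_mono) auto
        thus ?thesis using u(2)[of s y t1 S1] u(2)[of s "y - \<kappa>" t1 "S1 - \<kappa>"] by auto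
      qed
      also have "u t1 S1 - u t1 (S1 - \<kappa>) \<le> (x + q) * \<kappa> + A * \<kappa>\<^sup>2"
        using k by (intro touch_left) auto
      also have "2 * L * (h + \<eta>) \<le> 2 * L * (2 * \<kappa>\<^sup>2)"
        using u(1) \<eta> by (intro mult_left_mono) (auto simp: h_def)
      finally have "p * \<kappa> \<le> (x + q + N * \<kappa>) * \<kappa>"
        by (simp add: N_def algebra_simps power2_eq_square)
      hence "p \<le> x + q + N * \<kappa>" using k by simp
      moreover have "0 \<le> N * \<kappa>" using C' k by simp
      ultimately show ?thesis
        using H_mono[of p "x + q + N * \<kappa>"] H_lip[of x "x + q + N * \<kappa>"] P by (simp add: b_def algebra_simps)
    qed
    have "(- b) * (t1 + h - t1) * (S1 - (S1 - \<eta>)) \<le> (- 1) * integral {S1 - \<eta>..S1} (\<lambda>y. u (t1 + h) y - u t1 y)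
        + 0 * integral {t1..t1 + h} (\<lambda>s. u s S1 - u s (S1 - \<eta>))"
    proof (rule integrated_differential_inequality[OF u(2)])
      show "AE (s, y) in lborel. t1 < s \<and> s < t1 + h \<and> S1 - \<eta> < y \<and> y < S1 \<longrightarrow>
        (\<exists>p q. ((\<lambda>r. u r y) has_real_derivative p) (at s) \<and>
               ((\<lambda>x. u s x) has_real_derivative q) (at y) \<and> - b \<le> (- 1) * p + 0 * q)"
        using ae
      proof eventually_elim
        case (elim v)
        show ?case
        proof (clarify, goal_cases)
          case (1 s y)
          have st: "0 < s" "s < T" using 1 t0 t1 h by auto
          have yR: "-R < y" "y < R" using 1 \<eta> D_box[OF \<open>(t1, S1) \<in> D\<close>] by auto
          from 1 st elim obtain p where "((\<lambda>r. w r y) has_real_derivative H p) (at s)"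
            "((\<lambda>x. w s x) has_real_derivative p) (at y)" by auto
          with 1 st yR show ?case using slope[of s y p] u(4)[of s y "H p"] u(5)[of s y p]
            by (intro exI[of _ "H p"] exI[of _ p]) auto
        qed
      qed
    qed (use h \<eta> in auto)
    hence I1: "integral {S1 - \<eta>..S1} (\<lambda>y. u (t1 + h) y - u t1 y) \<le> b * h * \<eta>" by simp
    have "integral {S1 - \<eta>..S1} (\<lambda>y. u (t1 + h) S1 - u t1 S1 - 2 * L * \<eta>)
        \<le> integral {S1 - \<eta>..S1} (\<lambda>y. u (t1 + h) y - u t1 y)"
    proof (rule integral_le)
      fix y assume y: "y \<in> {S1 - \<eta>..S1}"
      have "L * \<bar>S1 - y\<bar> \<le> L * \<eta>" using y u(1) by (intro mult_left_mono) auto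
      thus "u (t1 + h) S1 - u t1 S1 - 2 * L * \<eta> \<le> u (t1 + h) y - u t1 y"
        using u(2)[of "t1 + h" S1 "t1 + h" y] u(2)[of t1 S1 t1 y] by auto
    qed (auto intro!: integrable_continuous_interval continuous_intros cont)
    hence "\<eta> * (u (t1 + h) S1 - u t1 S1 - 2 * L * \<eta>) \<le> integral {S1 - \<eta>..S1} (\<lambda>y. u (t1 + h) y - u t1 y)"
      using \<eta> by simp
    with I1 have "\<eta> * (u (t1 + h) S1 - u t1 S1 - 2 * L * \<eta>) \<le> \<eta> * (b * h)" by (simp add: mult_ac)
    hence "u (t1 + h) S1 - u t1 S1 \<le> b * h + 2 * L * \<eta>" using \<eta> by simp
    with touch_time[of h] h have "h * (H x + \<delta> + M * q) - A * M\<^sup>2 * h\<^sup>2 \<le> b * h + 2 * L * \<eta>" by simp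
    hence "h * \<delta> \<le> h * (A * M\<^sup>2 * h + M * N * \<kappa> + 2 * L * \<kappa>)"
      by (simp add: b_def \<eta>_def algebra_simps power2_eq_square)
    hence "\<delta> \<le> A * M\<^sup>2 * h + M * N * \<kappa> + 2 * L * \<kappa>" using h by simp
    also have "A * M\<^sup>2 * h \<le> A * M\<^sup>2 * \<kappa>"
      using A(1) k by (intro mult_left_mono) (auto simp: h_def power2_eq_square)
    finally show ?thesis by (simp add: algebra_simps)
  qed
  have "((\<lambda>\<kappa>. (A * M\<^sup>2 + M * N + 2 * L) * \<kappa>) \<longlongrightarrow> (A * M\<^sup>2 + M * N + 2 * L) * 0) (at_right 0)"
    by (intro tendsto_intros)
  moreover have "eventually (\<lambda>\<kappa>. \<delta> \<le> (A * M\<^sup>2 + M * N + 2 * L) * \<kappa>) (at_right 0)"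
  proof -
    have sq: "((\<lambda>\<kappa>::real. \<kappa>\<^sup>2) \<longlongrightarrow> 0\<^sup>2) (at_right 0)" by (intro tendsto_intros)
    have "eventually (\<lambda>\<kappa>. \<kappa>\<^sup>2 < (T - t1) / 2) (at_right (0::real))"
      using t1 by (intro order_tendstoD(2)[OF sq]) auto
    moreover have "eventually (\<lambda>\<kappa>. \<kappa> \<in> {0<..<1}) (at_right (0::real))"
      "eventually (\<lambda>\<kappa>. \<kappa> \<in> {0<..<S1 - (S0 - r)}) (at_right (0::real))"
      using S1 by (intro eventually_at_right_real; simp)+
    ultimately show ?thesis by eventually_elim (auto intro!: key)
  qed
  ultimately have "\<delta> \<le> (A * M\<^sup>2 + M * N + 2 * L) * 0" by (intro tendsto_lowerbound) auto
  thus False using \<delta> by simp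
qed

section \<open>Truncated moments of a density\<close>

definition truncated_integral :: "(real \<Rightarrow> real) \<Rightarrow> ennreal \<Rightarrow> real" where
  "truncated_integral h x = (LINT p:{p. 0 < p \<and> ennreal p \<le> x}|lborel. h p)"

lemma F_ext_eq: "F_ext f = truncated_integral f"
  and G_ext_eq: "G_ext f = truncated_integral (\<lambda>p. p * f p)"
  by (simp_all add: fun_eq_iff F_ext_def G_ext_def truncated_integral_def)

lemma truncation_infinity: "{p. 0 < p \<and> ennreal p \<le> \<infinity>} = {0<..}"
  by auto

lemma truncation_real: "b \<ge> 0 \<Longrightarrow> {p. 0 < p \<and> ennreal p \<le> ennreal b} = {0<..b}"
  by auto

lemma set_integrable_truncation:
  fixes h :: "real \<Rightarrow> real"
  shows "set_integrable lborel {0<..} h \<Longrightarrow> set_integrable lborel {p. 0 < p \<and> ennreal p \<le> x} h"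
  by (rule set_integrable_subset[of lborel "{0<..}" h]) auto

text \<open>Dominated convergence in the topology of \<open>ennreal\<close>, so continuity at
  infinity is included. The indicators converge at every \<open>p\<close> other than the limit point
  itself.\<close>

lemma continuous_on_truncated_integral:
  assumes "set_integrable lborel {0<..} h"
  shows "continuous_on X (truncated_integral h)"
proof (rule continuous_on_subset)
  show "continuous_on UNIV (truncated_integral h)"
  proof (rule continuous_on_sequentiallyI)
    fix x :: "nat \<Rightarrow> ennreal" and a :: ennreal assume lim: "x \<longlonglongrightarrow> a"
    let ?A = "\<lambda>x. {p. 0 < p \<and> ennreal p \<le> x}"
    show "(\<lambda>n. truncated_integral h (x n)) \<longlonglongrightarrow> truncated_integral h a"
      unfolding truncated_integral_def set_lebesgue_integral_def
    proof (rule integral_dominated_convergence)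
      have meas: "(\<lambda>p. indicator (?A y) p *\<^sub>R h p) \<in> borel_measurable lborel" for y
        using set_integrable_truncation[OF assms, of y] unfolding set_integrable_def by simp
      show "(\<lambda>p. indicator (?A a) p *\<^sub>R h p) \<in> borel_measurable lborel"
        "(\<lambda>p. indicator (?A (x n)) p *\<^sub>R h p) \<in> borel_measurable lborel" for n
        by (rule meas)+
      show "integrable lborel (\<lambda>p. norm (indicator {0<..} p *\<^sub>R h p))"
        using assms unfolding set_integrable_def by (rule integrable_norm)
      show "AE p in lborel. norm (indicator (?A (x n)) p *\<^sub>R h p) \<le> norm (indicator {0<..} p *\<^sub>R h p)" for n
        by (intro always_eventually) (auto simp: indicator_def)
      show "AE p in lborel. (\<lambda>n. indicator (?A (x n)) p *\<^sub>R h p) \<longlonglongrightarrow> indicator (?A a) p *\<^sub>R h p"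
        \<comment> \<open>For infinite \<open>a\<close> the default value
          \<open>enn2real a = 0\<close> excludes only the point 0.\<close>
        using AE_lborel_singleton[of "enn2real a"]
      proof eventually_elim
        case (elim p)
        show ?case
        proof (cases "p > 0")
          case True
          have "ennreal p \<noteq> a" using elim True by auto
          hence "eventually (\<lambda>n. ennreal p \<le> x n \<longleftrightarrow> ennreal p \<le> a) sequentially"
          proof (cases "ennreal p < a")
            case True
            from order_tendstoD(1)[OF lim this] show ?thesis
              by eventually_elim (use True in auto)
          next
            case False
            with \<open>ennreal p \<noteq> a\<close> have "a < ennreal p" by auto
            from order_tendstoD(2)[OF lim this] show ?thesis
              by eventually_elim (use \<open>a < ennreal p\<close> in auto)
          qed
          hence "eventually (\<lambda>n. indicator (?A (x n)) p *\<^sub>R h p = indicator (?A a) p *\<^sub>R h p) sequentially"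
            by eventually_elim (auto simp: indicator_def)
          thus ?thesis by (rule tendsto_eventually)
        qed (simp add: indicator_def)
      qed
    qed
  qed
qed simp

lemma truncated_integral_mono:
  assumes "set_integrable lborel {0<..} h" "\<And>p. p > 0 \<Longrightarrow> 0 \<le> h p" "x \<le> y"
  shows "truncated_integral h x \<le> truncated_integral h y"
  unfolding truncated_integral_def set_lebesgue_integral_def
  using set_integrable_truncation[OF assms(1)] assms(2,3) unfolding set_integrable_def
  by (intro integral_mono) (auto simp: indicator_def)

lemma truncated_integral_zero: "truncated_integral h 0 = 0"
proof -
  have "{p. 0 < p \<and> ennreal p \<le> 0} = {}" by (auto simp: ennreal_eq_0_iff)
  thus ?thesis by (simp add: truncated_integral_def set_lebesgue_integral_def)
qed

lemma truncated_integral_nonneg: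
  assumes "set_integrable lborel {0<..} h" "\<And>p. p > 0 \<Longrightarrow> 0 \<le> h p"
  shows "0 \<le> truncated_integral h x"
  using truncated_integral_mono[OF assms, of 0 x] by (simp add: truncated_integral_zero)

text \<open>Up to \<open>N\<close> the integrand is below \<open>N * f p\<close>; beyond
  \<open>N\<close> the decay hypothesis puts it below \<open>1 / p ^ 2\<close>.\<close>

lemma set_integrable_first_moment:
  fixes f :: "real \<Rightarrow> real"
  assumes f: "set_integrable lborel {0<..} f" "\<And>p. p > 0 \<Longrightarrow> 0 \<le> f p"
    and decay: "((\<lambda>p. p ^ 3 * f p) \<longlongrightarrow> 0) at_top"
  shows "set_integrable lborel {0<..} (\<lambda>p. p * f p)"
proof -
  have "eventually (\<lambda>p. p ^ 3 * f p < 1) at_top" by (rule order_tendstoD(2)[OF decay]) simp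
  then obtain N0 where N0: "\<And>p. p \<ge> N0 \<Longrightarrow> p ^ 3 * f p < 1" by (auto simp: eventually_at_top_linorder)
  define N where "N = max N0 1"
  have N: "N \<ge> 1" "\<And>p. p \<ge> N \<Longrightarrow> p ^ 3 * f p < 1" using N0 by (auto simp: N_def)
  have tail: "integrable lborel (\<lambda>p. indicator {N..} p * (1 / p ^ 2))"
  proof -
    have "(\<lambda>p. 1 / p ^ 2) integrable_on {N..}"
      using has_integral_inverse_power_to_inf[of 2 N] N(1) by (auto simp: integrable_on_def)
    hence "(\<lambda>p. 1 / p ^ 2) absolutely_integrable_on {N..}"
      by (rule nonnegative_absolutely_integrable_1) auto
    thus ?thesis unfolding set_integrable_def by (subst (asm) integrable_completion) auto
  qed
  let ?h = "\<lambda>p. N * (indicator {0<..} p * f p) + indicator {N..} p * (1 / p ^ 2)"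
  have meas: "(\<lambda>p. indicator {0<..} p * f p) \<in> borel_measurable lborel"
    using f(1) unfolding set_integrable_def by simp
  have "integrable lborel (\<lambda>p. p * (indicator {0<..} p * f p))"
  proof (rule Bochner_Integration.integrable_bound)
    show "integrable lborel ?h"
      using f(1) tail unfolding set_integrable_def
      by (intro Bochner_Integration.integrable_add integrable_mult_right) auto
    show "AE p in lborel. norm (p * (indicator {0<..} p * f p)) \<le> norm (?h p)"
    proof (intro always_eventually allI)
      fix p
      consider "p \<le> 0" | "0 < p" "p < N" | "N \<le> p" by linarith
      thus "norm (p * (indicator {0<..} p * f p)) \<le> norm (?h p)"
      proof cases
        case 2
        hence "p * f p \<le> N * f p" using f(2) by (intro mult_right_mono) auto
        thus ?thesis using 2 f(2)[of p] by simp
      next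
        case 3
        hence p: "p > 0" using N(1) by simp
        have "p * f p = p ^ 3 * f p / p ^ 2" using p by (simp add: power2_eq_square power3_eq_cube)
        also have "\<dots> \<le> 1 / p ^ 2" using N(2)[OF 3] p by (intro divide_right_mono) auto
        also have "\<dots> \<le> N * f p + 1 / p ^ 2" using f(2)[OF p] N(1) by simp
        finally show ?thesis using 3 p f(2)[of p] N(1) by simp
      qed simp
    qed
  qed (use meas in measurable)
  thus ?thesis by (simp add: set_integrable_def mult.left_commute)
qed

section \<open>Threshold controls and the integrand of the Hamiltonian\<close>

text \<open>The zero of \<open>a + x * p\<close> in \<open>p\<close>. Division in
  \<open>ennreal\<close> returns infinity for \<open>a > 0\<close> and 0 for \<open>a = 0\<close> at
  \<open>x = 0\<close>, which are the limits from the left, so the map is continuous there.\<close>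

definition threshold :: "real \<Rightarrow> real \<Rightarrow> ennreal" where
  "threshold a x = ennreal a / ennreal (- x)"

lemma threshold_neg: "a \<ge> 0 \<Longrightarrow> x < 0 \<Longrightarrow> threshold a x = ennreal (a / (- x))"
  unfolding threshold_def by (rule divide_ennreal) auto

lemma threshold_zero: "threshold a 0 = (if a > 0 then \<infinity> else 0)"
  by (auto simp: threshold_def ennreal_eq_0_iff)

lemma threshold_sign:
  assumes "a \<ge> 0" "x \<le> 0" "p > 0"
  shows "ennreal p \<le> threshold a x \<Longrightarrow> 0 \<le> a + x * p"
    and "\<not> ennreal p \<le> threshold a x \<Longrightarrow> a + x * p \<le> 0"
proof -
  show "ennreal p \<le> threshold a x \<Longrightarrow> 0 \<le> a + x * p"
    using assms by (cases "x = 0") (auto simp: threshold_neg field_simps)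
  show "\<not> ennreal p \<le> threshold a x \<Longrightarrow> a + x * p \<le> 0"
    using assms by (cases "x = 0") (auto simp: threshold_neg threshold_zero field_simps split: if_splits)
qed

lemma threshold_mono:
  assumes "a \<ge> 0" "x \<le> y" "y \<le> 0"
  shows "threshold a x \<le> threshold a y"
proof -
  consider "a = 0" | "x = y" | "a > 0" "y = 0" | "x < 0" "y < 0" using assms by linarith
  thus ?thesis
  proof cases
    case 1
    thus ?thesis by (simp add: threshold_def)
  next
    case 4
    thus ?thesis using assms by (simp add: threshold_neg ennreal_leI frac_le del: divide_minus_right)
  qed (simp_all add: threshold_zero)
qed

lemma continuous_on_threshold: "continuous_on X (threshold a)"
proof -
  have "continuous_on X (\<lambda>x. inverse (ennreal (- x)))"
    by (intro continuous_on_inverse_ennreal continuous_on_ennreal continuous_on_minus continuous_on_id)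
  thus ?thesis unfolding threshold_def divide_ennreal_def continuous_on_def
    by (auto intro!: ennreal_tendsto_cmult)
qed

text \<open>The integral inside \<open>H_single\<close>, extended to infinite control values;
  \<open>x\<close> acts as the multiplier of the cash spent.\<close>

definition lagrangian :: "real \<Rightarrow> (real \<Rightarrow> real) \<Rightarrow> real \<Rightarrow> ennreal \<Rightarrow> real" where
  "lagrangian a f x b = a * F_ext f b + x * G_ext f b"

locale decaying_density =
  fixes f :: "real \<Rightarrow> real"
  assumes density: "density_on_pos f" and decay: "((\<lambda>p. p ^ 3 * f p) \<longlongrightarrow> 0) at_top"
begin

lemma f_nonneg: "p > 0 \<Longrightarrow> 0 \<le> f p"
  and f_integrable: "set_integrable lborel {0<..} f"
  and f_mass: "(LINT p:{0<..}|lborel. f p) = 1"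
  using density by (auto simp: density_on_pos_def)

lemma moment_integrable: "set_integrable lborel {0<..} (\<lambda>p. p * f p)"
  by (rule set_integrable_first_moment[OF f_integrable f_nonneg decay])

lemma moment_nonneg: "p > 0 \<Longrightarrow> 0 \<le> p * f p"
  by (simp add: f_nonneg)

lemma F_infinity: "F_ext f \<infinity> = 1"
  by (simp only: F_ext_def truncation_infinity f_mass)

lemma G_infinity: "G_ext f \<infinity> = (LINT p:{0<..}|lborel. p * f p)"
  by (simp only: G_ext_def truncation_infinity)

lemma F_bounds: "0 \<le> F_ext f b" "F_ext f b \<le> 1"
  using truncated_integral_nonneg[OF f_integrable f_nonneg, of b] 
    truncated_integral_mono[OF f_integrable f_nonneg, of b \<infinity>] F_infinity
  by (simp_all add: F_ext_eq)

lemma G_mono: "b \<le> c \<Longrightarrow> G_ext f b \<le> G_ext f c"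
  unfolding G_ext_eq by (rule truncated_integral_mono[OF moment_integrable moment_nonneg])

lemma G_bounds: "0 \<le> G_ext f b" "G_ext f b \<le> G_ext f \<infinity>"
  using truncated_integral_nonneg[OF moment_integrable moment_nonneg, of b] G_mono[of b \<infinity>]
  by (simp_all add: G_ext_eq)

lemma F_zero: "F_ext f 0 = 0" and G_zero: "G_ext f 0 = 0"
  by (simp_all add: F_ext_eq G_ext_eq truncated_integral_zero)

lemma continuous_on_F: "continuous_on X (F_ext f)" and continuous_on_G: "continuous_on X (G_ext f)"
  unfolding F_ext_eq G_ext_eq
  by (intro continuous_on_truncated_integral f_integrable moment_integrable)+

lemma F_measurable: "F_ext f \<in> borel_measurable borel" and G_measurable: "G_ext f \<in> borel_measurable borel"
  by (intro borel_measurable_continuous_onI continuous_on_F continuous_on_G)+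

lemma lagrangian_integrable: "set_integrable lborel {0<..} (\<lambda>p. f p * (a + x * p))"
proof -
  have "set_integrable lborel {0<..} (\<lambda>p. a * f p + x * (p * f p))"
    by (intro set_integral_add set_integrable_mult_right f_integrable moment_integrable)
  thus ?thesis by (simp add: algebra_simps)
qed

lemma lagrangian_eq: "lagrangian a f x b = truncated_integral (\<lambda>p. f p * (a + x * p)) b"
proof -
  let ?A = "{p. 0 < p \<and> ennreal p \<le> b}"
  have "truncated_integral (\<lambda>p. f p * (a + x * p)) b = (LINT p:?A|lborel. a * f p + x * (p * f p))"
    unfolding truncated_integral_def by (simp add: algebra_simps)
  also have "\<dots> = (LINT p:?A|lborel. a * f p) + (LINT p:?A|lborel. x * (p * f p))"
    by (intro set_integral_add set_integrable_mult_right set_integrable_truncation f_integrable moment_integrable)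
  finally show ?thesis
    by (simp only: lagrangian_def F_ext_def G_ext_def set_integral_mult_right)
qed

lemma lagrangian_real:
  "b \<ge> 0 \<Longrightarrow> lagrangian a f x (ennreal b) = (LINT p:{0<..b}|lborel. f p * (a + x * p))"
  by (simp only: lagrangian_eq truncated_integral_def truncation_real)

lemma H_single_eq_Sup_lagrangian:
  "H_single l a f x = l * (SUP b\<in>{0..}. lagrangian a f x (ennreal b))"
  unfolding H_single_def by (intro arg_cong[where f = "times l"] SUP_cong) (auto simp: lagrangian_real)

lemma bdd_above_lagrangian: "bdd_above ((\<lambda>b. lagrangian a f x (ennreal b)) ` {0..})"
proof (rule bdd_aboveI2)
  fix b
  have "a * F_ext f (ennreal b) \<le> \<bar>a\<bar> * 1"
    using F_bounds[of "ennreal b"] by (intro mult_mono) auto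
  moreover have "x * G_ext f (ennreal b) \<le> \<bar>x\<bar> * G_ext f \<infinity>"
    using G_bounds[of "ennreal b"] by (intro mult_mono) auto
  ultimately show "lagrangian a f x (ennreal b) \<le> \<bar>a\<bar> * 1 + \<bar>x\<bar> * G_ext f \<infinity>"
    by (simp add: lagrangian_def)
qed

lemma continuous_on_lagrangian: "continuous_on X (lagrangian a f x)"
  unfolding lagrangian_def by (intro continuous_intros continuous_on_F continuous_on_G)

text \<open>The supremum runs over real values only, whereas a control may be infinite. Continuity
  at infinity closes this gap.\<close>

lemma lagrangian_le_Sup: "lagrangian a f x b \<le> (SUP b\<in>{0..}. lagrangian a f x (ennreal b))"
proof (cases "b = \<infinity>")
  case True
  have "(\<lambda>n. ennreal (real n)) \<longlonglongrightarrow> \<infinity>"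
    using of_nat_tendsto_top_ennreal by (simp add: ennreal_of_nat_eq_real_of_nat)
  moreover have "isCont (lagrangian a f x) \<infinity>"
    using continuous_on_lagrangian[of UNIV] by (simp add: continuous_on_eq_continuous_at)
  ultimately have "(\<lambda>n. lagrangian a f x (ennreal (real n))) \<longlonglongrightarrow> lagrangian a f x \<infinity>"
    by (intro isCont_tendsto_compose[of \<infinity> "lagrangian a f x"])
  thus ?thesis unfolding True
    by (rule LIMSEQ_le_const2) (auto intro!: cSUP_upper bdd_above_lagrangian)
next
  case False
  then obtain r where "r \<ge> 0" "b = ennreal r" by (cases b) auto
  thus ?thesis by (auto intro!: cSUP_upper bdd_above_lagrangian)
qed

lemma lagrangian_le_H_single: "l \<ge> 0 \<Longrightarrow> l * lagrangian a f x b \<le> H_single l a f x"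
  unfolding H_single_eq_Sup_lagrangian by (intro mult_left_mono lagrangian_le_Sup)

lemma H_single_eq_if_maximal:
  assumes "\<And>b. lagrangian a f x b \<le> lagrangian a f x b0"
  shows "H_single l a f x = l * lagrangian a f x b0"
proof -
  have "(SUP b\<in>{0..}. lagrangian a f x (ennreal b)) = lagrangian a f x b0"
    by (intro antisym cSUP_least lagrangian_le_Sup assms) auto
  thus ?thesis by (simp add: H_single_eq_Sup_lagrangian)
qed

text \<open>Truncation at the threshold keeps the points where the integrand is nonnegative and
  drops those where it is nonpositive, so the comparison is pointwise.\<close>

lemma lagrangian_le_threshold:
  assumes "a \<ge> 0" "x \<le> 0"
  shows "lagrangian a f x b \<le> lagrangian a f x (threshold a x)"
  unfolding lagrangian_eq truncated_integral_def set_lebesgue_integral_def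
proof (rule integral_mono)
  fix p
  let ?A = "\<lambda>x. {p. 0 < p \<and> ennreal p \<le> x}"
  show "indicator (?A b) p *\<^sub>R (f p * (a + x * p)) \<le> indicator (?A (threshold a x)) p *\<^sub>R (f p * (a + x * p))"
  proof (cases "p > 0")
    case True
    show ?thesis
      using threshold_sign[OF assms True] f_nonneg[OF True]
      by (auto simp: indicator_def True mult_nonneg_nonpos)
  qed (simp add: indicator_def)
qed (use set_integrable_truncation[OF lagrangian_integrable] in \<open>auto simp: set_integrable_def\<close>)

lemma lagrangian_le_infinity:
  assumes "a \<ge> 0" "x \<ge> 0"
  shows "lagrangian a f x b \<le> lagrangian a f x \<infinity>"
  unfolding lagrangian_def using assms F_bounds[of b] F_infinity G_bounds[of b]
  by (intro add_mono mult_left_mono) auto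

end

section \<open>Duality\<close>

lemma set_integrable_bounded_control:
  fixes \<phi> :: "ennreal \<Rightarrow> real" and b :: "real \<Rightarrow> ennreal"
  assumes b: "b \<in> borel_measurable (lebesgue_on {t..s})" and \<phi>: "\<phi> \<in> borel_measurable borel"
    and bound: "\<And>x. \<bar>\<phi> x\<bar> \<le> B"
  shows "set_integrable lebesgue {t..s} (\<lambda>u. \<phi> (b u))"
proof -
  interpret finite_measure "lebesgue_on {t..s}" by (rule finite_measure_lebesgue_on) simp
  have "integrable (lebesgue_on {t..s}) (\<lambda>u. \<phi> (b u))"
    by (rule integrable_const_bound[of _ B]) (use bound measurable_compose[OF b \<phi>] in auto)
  thus ?thesis unfolding set_integrable_def by (subst (asm) integrable_restrict_space) auto
qed

lemma set_integral_finite_sum: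
  fixes h :: "'i \<Rightarrow> real \<Rightarrow> real"
  assumes "\<And>i. i \<in> I \<Longrightarrow> set_integrable M A (h i)"
  shows "set_integrable M A (\<lambda>u. \<Sum>i\<in>I. h i u)"
    and "(LINT u:A|M. \<Sum>i\<in>I. h i u) = (\<Sum>i\<in>I. LINT u:A|M. h i u)"
  using assms unfolding set_integrable_def set_lebesgue_integral_def scaleR_sum_right
  by (auto intro!: Bochner_Integration.integral_sum)

lemma set_integral_const_interval: "t \<le> s \<Longrightarrow> (LINT u:{t..s}|lebesgue. (c::real)) = (s - t) * c"
  by (simp add: set_lebesgue_integral_def)

lemma set_integrable_const_interval: "set_integrable lebesgue {t..s::real} (\<lambda>u. c::real)"
  using set_integrable_bounded_control[of "\<lambda>_. 0" t s "\<lambda>_. c" "\<bar>c\<bar>"] by simp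

locale execution_problem =
  fixes J :: nat and T K :: real and lam \<alpha> :: "nat \<Rightarrow> real" and f :: "nat \<Rightarrow> real \<Rightarrow> real"
  assumes T: "T > 0" and K: "K > 0"
    and lam: "\<And>j. j \<in> {1..J} \<Longrightarrow> lam j > 0"
    and alpha: "\<And>j. j \<in> {1..J} \<Longrightarrow> \<alpha> j \<ge> 0"
    and dens: "\<And>j. j \<in> {1..J} \<Longrightarrow> decaying_density (f j)"
begin

definition speed :: "(nat \<Rightarrow> ennreal) \<Rightarrow> real" where
  "speed b = (\<Sum>j=1..J. lam j * G_ext (f j) (b j))"

definition reward :: "(nat \<Rightarrow> ennreal) \<Rightarrow> real" where
  "reward b = (\<Sum>j=1..J. lam j * \<alpha> j * F_ext (f j) (b j))"

abbreviation H :: "real \<Rightarrow> real" where "H \<equiv> hamiltonian J lam \<alpha> f"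

definition max_speed :: real where "max_speed = speed (\<lambda>_. \<infinity>)"

definition thr :: "real \<Rightarrow> nat \<Rightarrow> ennreal" where "thr x = (\<lambda>j. threshold (\<alpha> j) x)"

text \<open>A selection from the subdifferential of H on the nonpositive axis: the derivative for
  \<open>x < 0\<close>, and at 0 the left derivative, to which assets with
  \<open>\<alpha> j = 0\<close> contribute nothing.\<close>

definition slope :: "real \<Rightarrow> real" where "slope x = speed (thr x)"

lemma reward_plus_speed:
  "reward b + x * speed b = (\<Sum>j=1..J. lam j * lagrangian (\<alpha> j) (f j) x (b j))"
  by (simp add: reward_def speed_def lagrangian_def sum_distrib_left sum.distrib[symmetric] algebra_simps)

text \<open>Each control vector gives a linear minorant of H. The convexity properties of H below
  are all drawn from these minorants.\<close>

lemma H_ge: "reward b + x * speed b \<le> H x"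
  unfolding reward_plus_speed hamiltonian_def
  by (intro sum_mono decaying_density.lagrangian_le_H_single dens less_imp_le[OF lam])

lemma H_threshold: "x \<le> 0 \<Longrightarrow> H x = reward (thr x) + x * slope x"
  unfolding slope_def reward_plus_speed hamiltonian_def thr_def
  by (intro sum.cong refl decaying_density.H_single_eq_if_maximal dens
        decaying_density.lagrangian_le_threshold alpha)

lemma H_infinity: "x \<ge> 0 \<Longrightarrow> H x = reward (\<lambda>_. \<infinity>) + x * max_speed"
  unfolding max_speed_def reward_plus_speed hamiltonian_def
  by (intro sum.cong refl decaying_density.H_single_eq_if_maximal dens
        decaying_density.lagrangian_le_infinity alpha)

lemma speed_nonneg: "0 \<le> speed b"
  unfolding speed_def
  by (intro sum_nonneg mult_nonneg_nonneg decaying_density.G_bounds dens less_imp_le[OF lam])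

lemma speed_mono: "(\<And>j. j \<in> {1..J} \<Longrightarrow> b j \<le> c j) \<Longrightarrow> speed b \<le> speed c"
  unfolding speed_def
  by (intro sum_mono mult_left_mono decaying_density.G_mono dens less_imp_le[OF lam])

lemma speed_le_max: "speed b \<le> max_speed"
  unfolding max_speed_def by (rule speed_mono) simp

lemma max_speed_nonneg: "0 \<le> max_speed"
  unfolding max_speed_def by (rule speed_nonneg)

lemma max_speed_eq: "max_speed = (\<Sum>j=1..J. lam j * (LINT p:{0<..}|lborel. p * f j p))"
  unfolding max_speed_def speed_def
  by (intro sum.cong refl arg_cong2[where f = times] decaying_density.G_infinity dens)

lemma slope_nonneg: "0 \<le> slope x" and slope_le_max: "slope x \<le> max_speed"
  by (simp_all add: slope_def speed_nonneg speed_le_max)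

lemma slope_mono: "x \<le> y \<Longrightarrow> y \<le> 0 \<Longrightarrow> slope x \<le> slope y"
  unfolding slope_def thr_def by (intro speed_mono threshold_mono alpha)

lemma slope_zero_eq_max_speed: "(\<And>j. j \<in> {1..J} \<Longrightarrow> \<alpha> j > 0) \<Longrightarrow> slope 0 = max_speed"
  unfolding slope_def max_speed_def speed_def thr_def by (intro sum.cong refl) (simp add: threshold_zero)

lemma continuous_on_slope: "continuous_on X slope"
proof -
  have "continuous_on X (\<lambda>x. G_ext (f j) (threshold (\<alpha> j) x))" if "j \<in> {1..J}" for j
    by (rule continuous_on_compose2[OF decaying_density.continuous_on_G[OF dens[OF that], of UNIV]
          continuous_on_threshold]) simp
  thus ?thesis unfolding slope_def speed_def thr_def by (intro continuous_intros) auto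
qed

lemma H_subgradient_nonpos: "x \<le> 0 \<Longrightarrow> H x + slope x * (y - x) \<le> H y"
  using H_ge[of "thr x" y] H_threshold[of x] by (simp add: slope_def algebra_simps)

lemma H_subgradient_nonneg: "x \<ge> 0 \<Longrightarrow> H x + max_speed * (y - x) \<le> H y"
  using H_ge[of "\<lambda>_. \<infinity>" y] H_infinity[of x] by (simp add: max_speed_def algebra_simps)

text \<open>The bounds on \<open>d\<close> are what makes H nondecreasing and Lipschitz with
  constant \<open>max_speed\<close>.\<close>

lemma H_subgradient_exists: "\<exists>d. 0 \<le> d \<and> d \<le> max_speed \<and> (\<forall>y. H x + d * (y - x) \<le> H y)"
  using H_subgradient_nonpos[of x] H_subgradient_nonneg[of x] slope_nonneg[of x] slope_le_max[of x] max_speed_nonneg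
  by (cases "x \<le> 0") (auto intro: exI[of _ "slope x"] exI[of _ max_speed])

lemma H_mono: assumes "x \<le> y" shows "H x \<le> H y"
proof -
  obtain d where "0 \<le> d" "H x + d * (y - x) \<le> H y" using H_subgradient_exists by blast
  moreover have "0 \<le> d * (y - x)" using \<open>0 \<le> d\<close> assms by simp
  ultimately show ?thesis by simp
qed

lemma H_lipschitz: assumes "x \<le> y" shows "H y \<le> H x + max_speed * (y - x)"
proof -
  obtain d where "d \<le> max_speed" "H y + d * (x - y) \<le> H x" using H_subgradient_exists by blast
  moreover have "d * (y - x) \<le> max_speed * (y - x)" using \<open>d \<le> max_speed\<close> assms by (intro mult_right_mono) auto
  ultimately show ?thesis by (simp add: algebra_simps)
qed

lemma abs_H_diff_le: "\<bar>H x - H y\<bar> \<le> max_speed * \<bar>x - y\<bar>"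
  using H_mono[of x y] H_mono[of y x] H_lipschitz[of x y] H_lipschitz[of y x] by (cases "x \<le> y") auto

lemma H_nonneg: "0 \<le> H x"
proof -
  have "reward (\<lambda>_. 0) = 0" "speed (\<lambda>_. 0) = 0"
    unfolding reward_def speed_def
    by (intro sum.neutral ballI; simp add: decaying_density.F_zero decaying_density.G_zero dens)+
  thus ?thesis using H_ge[of "\<lambda>_. 0" x] by simp
qed

text \<open>The subgradient inequalities at \<open>x\<close> and at \<open>y\<close> squeeze the
  difference quotient between \<open>slope x\<close> and \<open>slope y\<close>, and
  \<open>slope\<close> is continuous.\<close>

lemma H_has_derivative: assumes "x < 0" shows "(H has_real_derivative slope x) (at x)"
proof -
  have cont: "(slope \<longlongrightarrow> slope x) (at x)"
    using continuous_on_slope[of UNIV] by (simp add: continuous_on_def)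
  have near: "eventually (\<lambda>y. y < 0 \<and> y \<noteq> x) (at x)"
    using order_tendstoD(2)[OF tendsto_ident_at[of x UNIV] assms]
    by (intro eventually_conj) (auto simp: eventually_at_filter)
  have "((\<lambda>y. (H y - H x) / (y - x) - slope x) \<longlongrightarrow> 0) (at x)"
  proof (rule Lim_null_comparison)
    show "eventually (\<lambda>y. norm ((H y - H x) / (y - x) - slope x) \<le> \<bar>slope y - slope x\<bar>) (at x)"
      using near
    proof eventually_elim
      case (elim y)
      have 1: "H x + slope x * (y - x) \<le> H y" "H y + slope y * (x - y) \<le> H x"
        using assms elim by (auto intro: H_subgradient_nonpos)
      show ?case
      proof (cases "y > x")
        case True
        hence "slope x \<le> (H y - H x) / (y - x)" "(H y - H x) / (y - x) \<le> slope y"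
          using 1 by (simp_all add: field_simps)
        thus ?thesis by simp
      next
        case False
        hence "y < x" using elim by simp
        hence "slope y \<le> (H y - H x) / (y - x)" "(H y - H x) / (y - x) \<le> slope x"
          using 1 by (simp_all add: field_simps)
        thus ?thesis by simp
      qed
    qed
    show "((\<lambda>y. \<bar>slope y - slope x\<bar>) \<longlongrightarrow> 0) (at x)"
      using tendsto_diff[OF cont tendsto_const[of "slope x"]] by (intro tendsto_rabs_zero) simp
  qed
  from LIM_zero_cancel[OF this] show ?thesis by (simp add: has_field_derivative_iff)
qed

section \<open>First order condition and dual objective\<close>

text \<open>For \<open>x < 0\<close>, \<open>S - \<Psi> t x\<close> is the derivative of the dual
  objective at \<open>x\<close>.\<close>

definition \<Psi> :: "real \<Rightarrow> real \<Rightarrow> real" where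
  "\<Psi> t x = (T - t) * slope x + x / (2 * K)"

text \<open>The first order condition for a maximum of the concave dual objective over the
  nonpositive axis: a vanishing derivative at an interior point, a nonnegative left derivative at
  the boundary point 0.\<close>

definition optimal_slope :: "real \<Rightarrow> real \<Rightarrow> real \<Rightarrow> bool" where
  "optimal_slope t S x \<longleftrightarrow> x \<le> 0 \<and> \<Psi> t x \<le> S \<and> (x < 0 \<longrightarrow> S = \<Psi> t x)"

definition opt :: "real \<Rightarrow> real \<Rightarrow> real" where
  "opt t S = (SOME x. optimal_slope t S x)"

lemma \<Psi>_strict_mono: "t \<le> T \<Longrightarrow> x < y \<Longrightarrow> y \<le> 0 \<Longrightarrow> \<Psi> t x < \<Psi> t y"
  unfolding \<Psi>_def using K slope_mono[of x y]
  by (intro add_le_less_mono mult_left_mono divide_strict_right_mono) auto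

lemma optimal_slope_mono:
  assumes "t \<le> T" "optimal_slope t S x" "optimal_slope t S' x'" "S \<le> S'"
  shows "x \<le> x'"
proof (rule ccontr)
  assume "\<not> x \<le> x'"
  hence "x' < x" by simp
  moreover have "x \<le> 0" using assms(2) by (simp add: optimal_slope_def)
  ultimately have "\<Psi> t x' < \<Psi> t x" "x' < 0" using \<Psi>_strict_mono[OF assms(1)] by auto
  thus False using assms by (auto simp: optimal_slope_def)
qed

lemma optimal_slope_exists: assumes "t \<le> T" shows "\<exists>x. optimal_slope t S x"
proof (cases "\<Psi> t 0 \<le> S")
  case True
  thus ?thesis by (auto simp: optimal_slope_def)
next
  case False
  \<comment> \<open>Since \<open>slope\<close> is at most \<open>max_speed\<close>, this point lies
    far enough to the left for \<open>\<Psi> t a \<le> S\<close>, the lower end for the intermediate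
    value theorem.\<close>
  define a where "a = min 0 (2 * K * (S - (T - t) * max_speed))"
  have "(T - t) * slope a \<le> (T - t) * max_speed" using assms slope_le_max by (intro mult_left_mono) auto
  moreover have "a / (2 * K) \<le> S - (T - t) * max_speed"
    using K by (auto simp: a_def field_simps min_def)
  ultimately have "\<Psi> t a \<le> S" by (simp add: \<Psi>_def)
  moreover have "continuous_on {a..0} (\<Psi> t)"
    unfolding \<Psi>_def by (intro continuous_intros continuous_on_slope) (use K in auto)
  moreover have "a \<le> 0" by (simp add: a_def)
  ultimately obtain x where "a \<le> x" "x \<le> 0" "\<Psi> t x = S"
    using IVT'[of "\<Psi> t" a S 0] False by auto
  thus ?thesis by (auto simp: optimal_slope_def)
qed

lemma opt: "t \<le> T \<Longrightarrow> optimal_slope t S (opt t S)"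
  unfolding opt_def by (rule someI_ex[OF optimal_slope_exists])

lemma opt_eqI: "t \<le> T \<Longrightarrow> optimal_slope t S x \<Longrightarrow> opt t S = x"
  by (intro antisym; rule optimal_slope_mono[of t S _ S]; simp add: opt)

lemma opt_nonpos: "t \<le> T \<Longrightarrow> opt t S \<le> 0"
  using opt[of t S] by (simp add: optimal_slope_def)

definition dual_objective :: "real \<Rightarrow> real \<Rightarrow> real \<Rightarrow> real" where
  "dual_objective t S x = S * x - (T - t) * H x - x\<^sup>2 / (4 * K)"

definition V :: "real \<Rightarrow> real \<Rightarrow> real" where
  "V t S = dual_objective t S (opt t S)"

text \<open>Strong concavity: the quadratic gap stems from \<open>x\<^sup>2 / (4 * K)\<close>, the
  rest from the subgradient inequality of H. The gap is what later makes \<open>opt\<close>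
  Lipschitz, without any second derivative of H.\<close>

lemma dual_objective_le:
  assumes t: "t \<le> T" and y: "y \<le> 0"
  shows "dual_objective t S y \<le> V t S - (y - opt t S)\<^sup>2 / (4 * K)"
proof -
  define x where "x = opt t S"
  have x: "x \<le> 0" "\<Psi> t x \<le> S" "x < 0 \<Longrightarrow> S = \<Psi> t x"
    using opt[OF t, of S] by (auto simp: x_def optimal_slope_def)
  have "(T - t) * (H x + slope x * (y - x)) \<le> (T - t) * H y"
    using t x by (intro mult_left_mono H_subgradient_nonpos) auto
  hence "(T - t) * H x + (T - t) * slope x * (y - x) \<le> (T - t) * H y" by (simp add: algebra_simps)
  \<comment> \<open>For \<open>x < 0\<close> the first factor vanishes; for \<open>x = 0\<close> it
    is nonnegative and \<open>y \<le> 0\<close>.\<close>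
  moreover have "(S - \<Psi> t x) * (y - x) \<le> 0"
    using x y by (cases "x < 0") (auto intro!: mult_nonneg_nonpos)
  hence "S * y - S * x \<le> \<Psi> t x * (y - x)" by (simp add: algebra_simps)
  moreover have "\<Psi> t x * (y - x) = (T - t) * slope x * (y - x) + (y\<^sup>2 - x\<^sup>2 - (y - x)\<^sup>2) / (4 * K)"
    using K by (simp add: \<Psi>_def field_simps power2_eq_square)
  ultimately have "S * y - S * x \<le> (T - t) * H y - (T - t) * H x + (y\<^sup>2 - x\<^sup>2 - (y - x)\<^sup>2) / (4 * K)"
    by linarith
  thus ?thesis
    unfolding V_def dual_objective_def x_def[symmetric] diff_divide_distrib by linarith
qed

lemma dual_objective_le_V: "t \<le> T \<Longrightarrow> y \<le> 0 \<Longrightarrow> dual_objective t S y \<le> V t S"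
  using dual_objective_le[of t y S] K by (smt (verit) divide_nonneg_pos zero_le_power2)

lemma V_eq_SUP: "t \<le> T \<Longrightarrow> V t S = (SUP x\<in>{..0}. S * x - (T - t) * H x - x\<^sup>2 / (4 * K))"
  unfolding dual_objective_def[symmetric]
proof (rule cSup_eq_maximum[symmetric])
  assume "t \<le> T"
  thus "V t S \<in> dual_objective t S ` {..0}" by (auto simp: V_def opt_nonpos)
  fix v assume "v \<in> dual_objective t S ` {..0}"
  thus "v \<le> V t S" using dual_objective_le_V \<open>t \<le> T\<close> by auto
qed

text \<open>The Fenchel-Young inequality for the terminal penalty, whose convex conjugate on the
  nonpositive axis is \<open>x\<^sup>2 / (4 * K)\<close>. The difference is a completed
  square.\<close>

lemma penalty_ge: "x \<le> 0 \<Longrightarrow> x * y - x\<^sup>2 / (4 * K) \<le> K * (min y 0)\<^sup>2"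
proof -
  assume x: "x \<le> 0"
  have "x * y \<le> x * min y 0" using x by (intro mult_left_mono_neg) auto
  moreover have "K * (min y 0)\<^sup>2 - x * min y 0 + x\<^sup>2 / (4 * K) = K * (min y 0 - x / (2 * K))\<^sup>2"
    using K by (simp add: field_simps power2_eq_square)
  moreover have "K * (min y 0 - x / (2 * K))\<^sup>2 \<ge> 0" using K by simp
  ultimately show ?thesis by linarith
qed

text \<open>The equality case of the Fenchel-Young inequality, where the square vanishes or, for
  \<open>x = 0\<close>, the penalty does.\<close>

lemma penalty_eq:
  assumes "x \<le> 0" "x < 0 \<Longrightarrow> y = x / (2 * K)" "x = 0 \<Longrightarrow> y \<ge> 0"
  shows "K * (min y 0)\<^sup>2 = x * y - x\<^sup>2 / (4 * K)"
proof (cases "x = 0")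
  case False
  hence "y = x / (2 * K)" and y: "y < 0" using assms K by (auto simp: divide_neg_pos)
  hence x: "x = 2 * K * y" using K by simp
  show ?thesis using y K unfolding x by (simp add: power2_eq_square)
qed (use assms in simp)

section \<open>Costs of admissible controls and duality without gap\<close>

lemma admissible_integrable:
  assumes "admissible J T t b" "s \<le> T" "j \<in> {1..J}"
  shows "set_integrable lebesgue {t..s} (\<lambda>u. F_ext (f j) (b j u))"
    and "set_integrable lebesgue {t..s} (\<lambda>u. G_ext (f j) (b j u))"
proof -
  interpret decaying_density "f j" by (rule dens[OF assms(3)])
  have "b j \<in> borel_measurable (lebesgue_on {t..T})" using assms by (auto simp: admissible_def)
  hence meas: "b j \<in> borel_measurable (lebesgue_on {t..s})"
    using assms(2) by (intro measurable_restrict_mono[of _ lebesgue "{t..T}" borel "{t..s}"]) auto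
  show "set_integrable lebesgue {t..s} (\<lambda>u. F_ext (f j) (b j u))"
    by (rule set_integrable_bounded_control[OF meas F_measurable, of 1]) (use F_bounds in auto)
  show "set_integrable lebesgue {t..s} (\<lambda>u. G_ext (f j) (b j u))"
    by (rule set_integrable_bounded_control[OF meas G_measurable, of "G_ext (f j) \<infinity>"]) (use G_bounds in auto)
qed

lemma integral_speed:
  assumes "admissible J T t b" "s \<le> T"
  shows "set_integrable lebesgue {t..s} (\<lambda>u. speed (\<lambda>j. b j u))"
    and "(LINT u:{t..s}|lebesgue. speed (\<lambda>j. b j u)) = (\<Sum>j=1..J. lam j * (LINT u:{t..s}|lebesgue. G_ext (f j) (b j u)))"
proof -
  have *: "set_integrable lebesgue {t..s} (\<lambda>u. lam j * G_ext (f j) (b j u))" if "j \<in> {1..J}" for j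
    using admissible_integrable(2)[OF assms that] by (rule set_integrable_mult_right)
  show "set_integrable lebesgue {t..s} (\<lambda>u. speed (\<lambda>j. b j u))"
    unfolding speed_def using * by (rule set_integral_finite_sum)
  show "(LINT u:{t..s}|lebesgue. speed (\<lambda>j. b j u)) = (\<Sum>j=1..J. lam j * (LINT u:{t..s}|lebesgue. G_ext (f j) (b j u)))"
    unfolding speed_def by (subst set_integral_finite_sum(2)[OF *]) auto
qed

lemma integral_reward:
  assumes "admissible J T t b"
  shows "set_integrable lebesgue {t..T} (\<lambda>u. reward (\<lambda>j. b j u))"
    and "(LINT u:{t..T}|lebesgue. reward (\<lambda>j. b j u)) = (\<Sum>j=1..J. lam j * \<alpha> j * (LINT u:{t..T}|lebesgue. F_ext (f j) (b j u)))"
proof -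
  have *: "set_integrable lebesgue {t..T} (\<lambda>u. lam j * \<alpha> j * F_ext (f j) (b j u))" if "j \<in> {1..J}" for j
    using admissible_integrable(1)[OF assms order_refl that] by (rule set_integrable_mult_right)
  show "set_integrable lebesgue {t..T} (\<lambda>u. reward (\<lambda>j. b j u))"
    unfolding reward_def using * by (rule set_integral_finite_sum)
  show "(LINT u:{t..T}|lebesgue. reward (\<lambda>j. b j u)) = (\<Sum>j=1..J. lam j * \<alpha> j * (LINT u:{t..T}|lebesgue. F_ext (f j) (b j u)))"
    unfolding reward_def by (subst set_integral_finite_sum(2)[OF *]) auto
qed

lemma state_eq:
  "admissible J T t b \<Longrightarrow> s \<le> T \<Longrightarrow> state J lam f b t S s = S - (LINT u:{t..s}|lebesgue. speed (\<lambda>j. b j u))"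
  by (simp add: state_def integral_speed(2))

lemma cost_eq:
  "admissible J T t b \<Longrightarrow> cost J T K lam \<alpha> f b t S =
     - (LINT u:{t..T}|lebesgue. reward (\<lambda>j. b j u)) + K * (min (state J lam f b t S T) 0)\<^sup>2"
  by (simp add: cost_def integral_reward(2))

lemma reward_plus_state:
  assumes "admissible J T t b"
  shows "set_integrable lebesgue {t..T} (\<lambda>u. reward (\<lambda>j. b j u) + x * speed (\<lambda>j. b j u))"
    and "(LINT u:{t..T}|lebesgue. reward (\<lambda>j. b j u)) + x * (S - state J lam f b t S T)
      = (LINT u:{t..T}|lebesgue. reward (\<lambda>j. b j u) + x * speed (\<lambda>j. b j u))"
  using integral_reward[OF assms] integral_speed[OF assms order_refl]
  by (auto simp: state_eq[OF assms] intro!: set_integral_add(1) set_integrable_mult_right)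

lemma cost_ge_dual_objective:
  assumes b: "admissible J T t b" and t: "t \<le> T" and x: "x \<le> 0"
  shows "dual_objective t S x \<le> cost J T K lam \<alpha> f b t S"
proof -
  have "(LINT u:{t..T}|lebesgue. reward (\<lambda>j. b j u)) + x * (S - state J lam f b t S T) \<le> (LINT u:{t..T}|lebesgue. H x)"
    unfolding reward_plus_state(2)[OF b]
    by (intro set_integral_mono reward_plus_state(1)[OF b] H_ge set_integrable_const_interval)
  also have "\<dots> = (T - t) * H x" by (rule set_integral_const_interval[OF t])
  finally show ?thesis
    using penalty_ge[OF x, of "state J lam f b t S T"]
    by (simp add: cost_eq[OF b] dual_objective_def algebra_simps)
qed

text \<open>The two inequalities behind the dual bound become equalities under these conditions.
  Controls may depend on time, so that both the constant control and the closed loop, which can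
  switch to infinity, are covered.\<close>

lemma cost_eq_dual_objective:
  assumes b: "admissible J T t b" and t: "t \<le> T" and x: "x \<le> 0"
    and pointwise: "\<And>u. u \<in> {t..T} \<Longrightarrow> reward (\<lambda>j. b j u) + x * speed (\<lambda>j. b j u) = H x"
    and final: "x < 0 \<Longrightarrow> state J lam f b t S T = x / (2 * K)" "x = 0 \<Longrightarrow> state J lam f b t S T \<ge> 0"
  shows "cost J T K lam \<alpha> f b t S = dual_objective t S x"
proof -
  have "(LINT u:{t..T}|lebesgue. reward (\<lambda>j. b j u)) + x * (S - state J lam f b t S T) = (LINT u:{t..T}|lebesgue. H x)"
    unfolding reward_plus_state(2)[OF b]
    using pointwise by (intro set_lebesgue_integral_cong) auto
  also have "\<dots> = (T - t) * H x" by (rule set_integral_const_interval[OF t])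
  finally show ?thesis
    using penalty_eq[OF x final]
    by (simp add: cost_eq[OF b] dual_objective_def algebra_simps)
qed

lemma admissible_constant: "admissible J T t (\<lambda>j s. b j)"
  by (simp add: admissible_def)

lemma value_fun_eq_V:
  assumes t: "t \<le> T"
  shows "value_fun J T K lam \<alpha> f t S = V t S"
  unfolding value_fun_def
proof (rule cInf_eq_minimum)
  let ?x = "opt t S" and ?b = "\<lambda>j (s::real). thr (opt t S) j"
  have x: "?x \<le> 0" "\<Psi> t ?x \<le> S" "?x < 0 \<Longrightarrow> S = \<Psi> t ?x"
    using opt[OF t, of S] by (auto simp: optimal_slope_def)
  \<comment> \<open>By the first order condition this final state is \<open>?x / (2 * K)\<close> if
    \<open>?x < 0\<close>, and nonnegative if \<open>?x = 0\<close>, which is the equality case of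
    the terminal penalty.\<close>
  have st: "state J lam f ?b t S T = S - (T - t) * slope ?x"
    by (simp add: state_eq[OF admissible_constant] set_integral_const_interval[OF t] slope_def)
  have "cost J T K lam \<alpha> f ?b t S = V t S"
    unfolding V_def using x st
    by (intro cost_eq_dual_objective admissible_constant t)
       (auto simp: H_threshold slope_def[symmetric] \<Psi>_def)
  thus "V t S \<in> (\<lambda>b. cost J T K lam \<alpha> f b t S) ` {b. admissible J T t b}"
    using admissible_constant[of t "thr ?x"] by (metis (no_types, lifting) image_eqI mem_Collect_eq)
  show "V t S \<le> c" if "c \<in> (\<lambda>b. cost J T K lam \<alpha> f b t S) ` {b. admissible J T t b}" for c
    using that x unfolding V_def by (auto intro!: cost_ge_dual_objective t)
qed

end

section \<open>The value function as weak solution\<close>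

lemma has_real_derivative_if_quadratic_error:
  fixes g :: "real \<Rightarrow> real"
  assumes "eventually (\<lambda>y. \<bar>g y - g x - d * (y - x)\<bar> \<le> C * (y - x)\<^sup>2) (at x)"
  shows "(g has_real_derivative d) (at x)"
proof -
  have "((\<lambda>y. (g y - g x) / (y - x) - d) \<longlongrightarrow> 0) (at x)"
  proof (rule Lim_null_comparison)
    have "eventually (\<lambda>y. y \<noteq> x) (at x)" by (simp add: eventually_at_filter)
    with assms show "eventually (\<lambda>y. norm ((g y - g x) / (y - x) - d) \<le> C * \<bar>y - x\<bar>) (at x)"
    proof eventually_elim
      case (elim y)
      have "\<bar>(g y - g x) / (y - x) - d\<bar> = \<bar>g y - g x - d * (y - x)\<bar> / \<bar>y - x\<bar>"
        using elim by (simp add: abs_divide[symmetric] diff_divide_distrib)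
      also have "\<dots> \<le> C * (y - x)\<^sup>2 / \<bar>y - x\<bar>" using elim by (intro divide_right_mono) auto
      also have "(y - x)\<^sup>2 = \<bar>y - x\<bar> * \<bar>y - x\<bar>" by (metis power2_abs power2_eq_square)
      also have "C * (r * r) / r = C * r" for r by simp
      finally show ?case by simp
    qed
    have "((\<lambda>y. C * \<bar>y - x\<bar>) \<longlongrightarrow> C * \<bar>x - x\<bar>) (at x)" by (intro tendsto_intros)
    thus "((\<lambda>y. C * \<bar>y - x\<bar>) \<longlongrightarrow> 0) (at x)" by simp
  qed
  from LIM_zero_cancel[OF this] show ?thesis by (simp add: has_field_derivative_iff)
qed

context execution_problem
begin

text \<open>The strong concavity inequalities at the two points, each tested with the other
  maximiser, are added. Only the products of \<open>S - S'\<close> with \<open>x - x'\<close> and of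
  \<open>t - t'\<close> with \<open>H x - H x'\<close> remain, and H is Lipschitz.\<close>

lemma opt_lipschitz:
  assumes t: "t \<le> T" "t' \<le> T"
  shows "\<bar>opt t S - opt t' S'\<bar> \<le> 2 * K * (\<bar>S - S'\<bar> + max_speed * \<bar>t - t'\<bar>)"
proof -
  define x x' where "x = opt t S" and "x' = opt t' S'"
  have "dual_objective t S x' \<le> dual_objective t S x - (x' - x)\<^sup>2 / (4 * K)"
    using dual_objective_le[OF t(1) opt_nonpos[OF t(2), of S'], of S] by (simp add: x_def x'_def V_def)
  moreover have "dual_objective t' S' x \<le> dual_objective t' S' x' - (x - x')\<^sup>2 / (4 * K)"
    using dual_objective_le[OF t(2) opt_nonpos[OF t(1), of S], of S'] by (simp add: x_def x'_def V_def)
  moreover have "(x - x')\<^sup>2 / (4 * K) = (x - x')\<^sup>2 / (2 * K) / 2" "(x' - x)\<^sup>2 = (x - x')\<^sup>2"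
    by (simp_all add: power2_commute)
  ultimately have "(x - x')\<^sup>2 / (2 * K) \<le> (S - S') * (x - x') + (t - t') * (H x - H x')"
    unfolding dual_objective_def by (simp add: algebra_simps)
  also have "\<dots> \<le> \<bar>S - S'\<bar> * \<bar>x - x'\<bar> + \<bar>t - t'\<bar> * \<bar>H x - H x'\<bar>"
    unfolding abs_mult[symmetric] by linarith
  also have "\<dots> \<le> \<bar>S - S'\<bar> * \<bar>x - x'\<bar> + \<bar>t - t'\<bar> * (max_speed * \<bar>x - x'\<bar>)"
    by (intro add_left_mono mult_left_mono abs_H_diff_le) simp
  finally have "\<bar>x - x'\<bar> * \<bar>x - x'\<bar> \<le> (2 * K * (\<bar>S - S'\<bar> + max_speed * \<bar>t - t'\<bar>)) * \<bar>x - x'\<bar>"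
    using K by (simp add: field_simps power2_eq_square)
  moreover have "0 \<le> 2 * K * (\<bar>S - S'\<bar> + max_speed * \<bar>t - t'\<bar>)"
    using K max_speed_nonneg by simp
  ultimately show ?thesis unfolding x_def[symmetric] x'_def[symmetric]
  proof (cases "x = x'")
    case False
    hence "0 < \<bar>x - x'\<bar>" by simp
    with \<open>\<bar>x - x'\<bar> * \<bar>x - x'\<bar> \<le> _\<close> show "\<bar>x - x'\<bar> \<le> 2 * K * (\<bar>S - S'\<bar> + max_speed * \<bar>t - t'\<bar>)"
      by (rule mult_right_le_imp_le)
  qed simp
qed

text \<open>The dual objective is affine in time and cash jointly, and the maximiser at
  \<open>(t, S)\<close> is a competitor at \<open>(r, S')\<close>. So V is convex, with
  \<open>opt\<close> and \<open>H\<close> of it as a subgradient.\<close>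

lemma V_ge_tangent:
  assumes "t \<le> T" "r \<le> T"
  shows "V t S + (S' - S) * opt t S + (r - t) * H (opt t S) \<le> V r S'"
  using dual_objective_le_V[OF assms(2) opt_nonpos[OF assms(1), of S], of S']
  by (simp add: V_def[of t S] dual_objective_def algebra_simps)

text \<open>Tangents at both points enclose the increment, and Lipschitz continuity of
  \<open>opt\<close> turns the gap into a quadratic one. This yields the derivative and, applied to
  \<open>z\<close> and \<open>- z\<close>, the semi-concavity constant \<open>4 * K\<close>.\<close>

lemma V_space_expansion:
  assumes t: "t \<le> T"
  shows "\<bar>V t S' - V t S - opt t S * (S' - S)\<bar> \<le> 2 * K * (S' - S)\<^sup>2"
proof -
  have "0 \<le> V t S' - V t S - opt t S * (S' - S)"
    using V_ge_tangent[OF t t, of S S'] by (simp add: algebra_simps)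
  moreover have "V t S' - V t S - opt t S * (S' - S) \<le> (opt t S' - opt t S) * (S' - S)"
    using V_ge_tangent[OF t t, of S' S] by (simp add: algebra_simps)
  moreover have "(opt t S' - opt t S) * (S' - S) \<le> \<bar>opt t S' - opt t S\<bar> * \<bar>S' - S\<bar>"
    unfolding abs_mult[symmetric] by simp
  moreover have "\<bar>opt t S' - opt t S\<bar> * \<bar>S' - S\<bar> \<le> (2 * K * \<bar>S' - S\<bar>) * \<bar>S' - S\<bar>"
    using opt_lipschitz[OF t t, of S' S] by (intro mult_right_mono) auto
  moreover have "(2 * K * \<bar>S' - S\<bar>) * \<bar>S' - S\<bar> = 2 * K * (S' - S)\<^sup>2"
    by (simp add: power2_eq_square)
  ultimately show ?thesis by linarith
qed

lemma V_time_expansion: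
  assumes t: "t \<le> T" and r: "r \<le> T"
  shows "\<bar>V r S - V t S - H (opt t S) * (r - t)\<bar> \<le> 2 * K * max_speed\<^sup>2 * (r - t)\<^sup>2"
proof -
  have "0 \<le> V r S - V t S - H (opt t S) * (r - t)"
    using V_ge_tangent[OF t r, of S S] by (simp add: algebra_simps)
  moreover have "V r S - V t S - H (opt t S) * (r - t) \<le> (H (opt r S) - H (opt t S)) * (r - t)"
    using V_ge_tangent[OF r t, of S S] by (simp add: algebra_simps)
  moreover have "(H (opt r S) - H (opt t S)) * (r - t) \<le> \<bar>H (opt r S) - H (opt t S)\<bar> * \<bar>r - t\<bar>"
    unfolding abs_mult[symmetric] by simp
  moreover have "\<bar>H (opt r S) - H (opt t S)\<bar> * \<bar>r - t\<bar> \<le> (max_speed * (2 * K * (max_speed * \<bar>r - t\<bar>))) * \<bar>r - t\<bar>"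
    using opt_lipschitz[OF r t, of S S] max_speed_nonneg
    by (intro mult_right_mono order_trans[OF abs_H_diff_le] mult_left_mono) auto
  moreover have "(max_speed * (2 * K * (max_speed * \<bar>r - t\<bar>))) * \<bar>r - t\<bar> = 2 * K * max_speed\<^sup>2 * (r - t)\<^sup>2"
    by (simp add: power2_eq_square)
  ultimately show ?thesis by linarith
qed

lemma V_has_space_derivative: "t \<le> T \<Longrightarrow> (V t has_real_derivative opt t S) (at S)"
  by (rule has_real_derivative_if_quadratic_error[where C = "2 * K"])
     (intro always_eventually allI V_space_expansion)

lemma V_has_time_derivative:
  assumes "t < T" shows "((\<lambda>r. V r S) has_real_derivative H (opt t S)) (at t)"
proof (rule has_real_derivative_if_quadratic_error)
  have "eventually (\<lambda>r. r < T) (at t)"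
    using order_tendstoD(2)[OF tendsto_ident_at[of t UNIV] assms] by simp
  thus "eventually (\<lambda>r. \<bar>V r S - V t S - H (opt t S) * (r - t)\<bar> \<le> 2 * K * max_speed\<^sup>2 * (r - t)\<^sup>2) (at t)"
    by eventually_elim (use assms in \<open>intro V_time_expansion; simp\<close>)
qed

lemma V_locally_lipschitz: "locally_lipschitz_on ({0..T} \<times> UNIV) (\<lambda>(t, S). V t S)"
  unfolding locally_lipschitz_on_def
proof
  fix z :: "real \<times> real"
  \<comment> \<open>A bound on \<open>opt\<close> over the unit ball around \<open>z\<close>,
    obtained from the Lipschitz estimate with \<open>(T, 0)\<close> as reference point.\<close>
  define X where "X = \<bar>opt T 0\<bar> + 2 * K * (\<bar>snd z\<bar> + 1 + max_speed * T)"
  have X0: "X \<ge> 0" using K T max_speed_nonneg by (simp add: X_def)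
  have Xb: "\<bar>opt t S\<bar> \<le> X" if "t \<in> {0..T}" "\<bar>S - snd z\<bar> \<le> 1" for t S
  proof -
    have "\<bar>opt t S - opt T 0\<bar> \<le> 2 * K * (\<bar>S - 0\<bar> + max_speed * \<bar>t - T\<bar>)"
      using that by (intro opt_lipschitz) auto
    also have "\<dots> \<le> 2 * K * (\<bar>snd z\<bar> + 1 + max_speed * T)"
      using that K max_speed_nonneg by (intro mult_left_mono add_mono) auto
    finally show ?thesis by (simp add: X_def)
  qed
  have Hb: "0 \<le> H (opt t S)" "H (opt t S) \<le> H 0" if "t \<in> {0..T}" for t S
    using that by (auto intro: H_nonneg H_mono opt_nonpos)
  have le: "V t' S' - V t S \<le> X * \<bar>S - S'\<bar> + H 0 * \<bar>t - t'\<bar>"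
    if "t \<in> {0..T}" "t' \<in> {0..T}" "\<bar>S' - snd z\<bar> \<le> 1" for t S t' S'
  proof -
    have "V t' S' - V t S \<le> (S' - S) * opt t' S' + (t' - t) * H (opt t' S')"
      using V_ge_tangent[of t' t S' S] that by (simp add: algebra_simps)
    also have "\<dots> \<le> \<bar>S' - S\<bar> * \<bar>opt t' S'\<bar> + \<bar>t' - t\<bar> * \<bar>H (opt t' S')\<bar>"
      unfolding abs_mult[symmetric] by linarith
    also have "\<dots> \<le> \<bar>S' - S\<bar> * X + \<bar>t' - t\<bar> * H 0"
      using Xb Hb[of t' S'] that by (intro add_mono mult_left_mono) auto
    finally show ?thesis by (simp add: abs_minus_commute mult.commute)
  qed
  have "(X + H 0)-lipschitz_on (cball z 1 \<inter> {0..T} \<times> UNIV) (\<lambda>(t, S). V t S)"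
  proof (rule lipschitz_onI)
    fix p q assume "p \<in> cball z 1 \<inter> {0..T} \<times> UNIV" "q \<in> cball z 1 \<inter> {0..T} \<times> UNIV"
    moreover obtain t S t' S' where pq: "p = (t, S)" "q = (t', S')" by (cases p, cases q)
    ultimately have t: "t \<in> {0..T}" "t' \<in> {0..T}" and "dist z (t, S) \<le> 1" "dist z (t', S') \<le> 1" by auto
    hence S: "\<bar>S - snd z\<bar> \<le> 1" "\<bar>S' - snd z\<bar> \<le> 1"
      using dist_snd_le[of z "(t, S)"] dist_snd_le[of z "(t', S')"] by (auto simp: dist_real_def)
    have "dist (V t S) (V t' S') \<le> X * \<bar>S - S'\<bar> + H 0 * \<bar>t - t'\<bar>"
      using le[OF t S(2), of S] le[OF t(2,1) S(1), of S'] by (auto simp: dist_real_def abs_minus_commute)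
    also have "\<dots> \<le> X * dist p q + H 0 * dist p q"
      using dist_snd_le[of p q] dist_fst_le[of p q] X0 H_nonneg
      by (intro add_mono mult_left_mono) (auto simp: pq dist_real_def)
    finally show "dist (case p of (t, S) \<Rightarrow> V t S) (case q of (t, S) \<Rightarrow> V t S) \<le> (X + H 0) * dist p q"
      by (simp add: pq algebra_simps)
  qed (use X0 H_nonneg in simp)
  thus "\<exists>u>0. \<exists>L. L-lipschitz_on (cball z u \<inter> {0..T} \<times> UNIV) (\<lambda>(t, S). V t S)"
    using zero_less_one by blast
qed

lemma V_terminal: "V T S = K * (min S 0)\<^sup>2"
proof -
  have o: "optimal_slope T S (opt T S)" by (rule opt) simp
  hence "K * (min S 0)\<^sup>2 = opt T S * S - (opt T S)\<^sup>2 / (4 * K)"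
    by (intro penalty_eq) (auto simp: optimal_slope_def \<Psi>_def)
  thus ?thesis by (simp add: V_def dual_objective_def mult.commute)
qed

lemma hamilton_jacobi_operator_eq:
  "- vt - (\<Sum>j=1..J. lam j * (INF b\<in>{0..}. - (LINT p:{0<..b}|lborel. f j p * (\<alpha> j + p * q)))) = H q - vt"
proof -
  have "(INF b\<in>{0..}. - (LINT p:{0<..b}|lborel. f j p * (\<alpha> j + p * q)))
      = - (SUP b\<in>{0..}. LINT p:{0<..b}|lborel. f j p * (\<alpha> j + q * p))" for j
    by (simp add: Inf_real_def image_image mult.commute[of q])
  thus ?thesis by (simp add: hamiltonian_def H_single_def sum_negf)
qed

lemma V_semiconcave:
  assumes "0 \<le> t" "t < T"
  shows "V t (S + z) - 2 * V t S + V t (S - z) \<le> 4 * K * (1 + 1 / (T - t)) * z\<^sup>2"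
proof -
  have "V t (S + z) - 2 * V t S + V t (S - z) \<le> 4 * K * 1 * z\<^sup>2"
    using V_space_expansion[of t "S + z" S] V_space_expansion[of t "S - z" S] assms by simp
  also have "\<dots> \<le> 4 * K * (1 + 1 / (T - t)) * z\<^sup>2"
    using assms K by (intro mult_right_mono mult_left_mono) auto
  finally show ?thesis .
qed

lemma value_fun_weak_semiconcave_solution:
  "weak_semiconcave_solution J T K lam \<alpha> f (value_fun J T K lam \<alpha> f)"
  unfolding weak_semiconcave_solution_def hamilton_jacobi_operator_eq
proof (intro conjI allI)
  show "locally_lipschitz_on ({0..T} \<times> UNIV) (\<lambda>(t, S). value_fun J T K lam \<alpha> f t S)"
    unfolding locally_lipschitz_on_def
  proof (rule ballI)
    fix z :: "real \<times> real" assume "z \<in> {0..T} \<times> UNIV"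
    hence "\<exists>u>0. \<exists>L. L-lipschitz_on (cball z u \<inter> {0..T} \<times> UNIV) (\<lambda>(t, S). V t S)"
      using V_locally_lipschitz unfolding locally_lipschitz_on_def by blast
    moreover have "L-lipschitz_on (cball z u \<inter> {0..T} \<times> UNIV) (\<lambda>(t, S). V t S) \<longleftrightarrow>
      L-lipschitz_on (cball z u \<inter> {0..T} \<times> UNIV) (\<lambda>(t, S). value_fun J T K lam \<alpha> f t S)" for L u
      by (intro lipschitz_on_cong refl) (auto simp: value_fun_eq_V)
    ultimately show "\<exists>u>0. \<exists>L. L-lipschitz_on (cball z u \<inter> {0..T} \<times> UNIV) (\<lambda>(t, S). value_fun J T K lam \<alpha> f t S)"
      by simp
  qed
  show "value_fun J T K lam \<alpha> f T S = K * (min S 0)\<^sup>2" for S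
    by (simp add: value_fun_eq_V V_terminal)
  show "AE (t, S) in lborel. 0 < t \<and> t < T \<longrightarrow>
        (\<exists>vt vS. ((\<lambda>r. value_fun J T K lam \<alpha> f r S) has_real_derivative vt) (at t) \<and>
                 (value_fun J T K lam \<alpha> f t has_real_derivative vS) (at S) \<and> H vS - vt = 0)"
  proof (intro always_eventually allI, clarify)
    fix t S :: real assume t: "0 < t" "t < T"
    have "((\<lambda>r. value_fun J T K lam \<alpha> f r S) has_real_derivative H (opt t S)) (at t)"
      by (rule has_field_derivative_transform_within_open[OF V_has_time_derivative[OF t(2)], of "{..<T}"])
         (use t in \<open>auto simp: value_fun_eq_V\<close>)
    moreover have "(value_fun J T K lam \<alpha> f t has_real_derivative opt t S) (at S)"
    proof -
      have "value_fun J T K lam \<alpha> f t = V t" using t by (auto simp: value_fun_eq_V)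
      thus ?thesis using V_has_space_derivative[of t S] t by simp
    qed
    ultimately show "\<exists>vt vS. ((\<lambda>r. value_fun J T K lam \<alpha> f r S) has_real_derivative vt) (at t) \<and>
                 (value_fun J T K lam \<alpha> f t has_real_derivative vS) (at S) \<and> H vS - vt = 0"
      by force
  qed
  show "\<exists>C\<ge>0. \<forall>t S z. 0 \<le> t \<and> t < T \<longrightarrow>
        value_fun J T K lam \<alpha> f t (S + z) - 2 * value_fun J T K lam \<alpha> f t S + value_fun J T K lam \<alpha> f t (S - z)
          \<le> C * (1 + 1 / (T - t)) * z\<^sup>2"
    using V_semiconcave K by (intro exI[of _ "4 * K"]) (simp add: value_fun_eq_V)
qed

section \<open>Uniqueness of weak solutions\<close>

text \<open>Both bounds at \<open>(t, S)\<close> use the same number \<open>x = opt t S\<close>. The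
  minorant of H belonging to \<open>thr x\<close> is exact at \<open>x\<close>, and its
  characteristic ends where the terminal penalty is in the equality case, so the upper bound meets
  the affine lower bound.\<close>

lemma weak_semiconcave_solution_unique:
  assumes w: "weak_semiconcave_solution J T K lam \<alpha> f w" and t: "0 \<le> t" "t \<le> T"
  shows "w t S = V t S"
proof -
  have ll: "locally_lipschitz_on ({0..T} \<times> UNIV) (\<lambda>(t, S). w t S)"
    and terminal: "\<And>S. w T S = K * (min S 0)\<^sup>2"
    and ae0: "AE (t, S) in lborel. 0 < t \<and> t < T \<longrightarrow> (\<exists>vt vS. ((\<lambda>r. w r S) has_real_derivative vt) (at t) \<and>
                 ((\<lambda>x. w t x) has_real_derivative vS) (at S) \<and> H vS - vt = 0)"
    using w unfolding weak_semiconcave_solution_def hamilton_jacobi_operator_eq by blast+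
  obtain C where C: "C \<ge> 0" and sc: "\<And>t S z. 0 \<le> t \<Longrightarrow> t < T \<Longrightarrow>
        w t (S + z) - 2 * w t S + w t (S - z) \<le> C * (1 + 1 / (T - t)) * z\<^sup>2"
    using w unfolding weak_semiconcave_solution_def by blast
  have ae: "AE (t, S) in lborel. 0 < t \<and> t < T \<longrightarrow>
        (\<exists>q. ((\<lambda>r. w r S) has_real_derivative H q) (at t) \<and> ((\<lambda>x. w t x) has_real_derivative q) (at S))"
    using ae0 by eventually_elim (auto simp: case_prod_unfold)
  define x where "x = opt t S"
  have x: "x \<le> 0" "\<Psi> t x \<le> S" "x < 0 \<Longrightarrow> S = \<Psi> t x"
    using opt[OF t(2), of S] by (auto simp: x_def optimal_slope_def)
  have Veq: "V t S = S * x - (T - t) * H x - x\<^sup>2 / (4 * K)"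
    by (simp add: V_def dual_objective_def x_def)
  show ?thesis
  proof (rule antisym)
    have "w t S + reward (thr x) * (T - t) \<le> w T (S - slope x * (T - t))"
      using H_ge[of "thr x"] slope_nonneg
      by (intro almost_everywhere_solution_le_characteristic[OF ll T ae] t)
         (auto simp: slope_def mult.commute)
    also have "\<dots> = x * (S - slope x * (T - t)) - x\<^sup>2 / (4 * K)"
      unfolding terminal using x by (intro penalty_eq) (auto simp: \<Psi>_def mult.commute)
    finally show "w t S \<le> V t S" by (simp add: Veq H_threshold[OF x(1)] algebra_simps)
    have "S * x - (T - t) * H x - x\<^sup>2 / (4 * K) \<le> w t S"
      using penalty_ge[OF x(1)] H_mono H_lipschitz
      by (intro semiconcave_solution_ge_affine[OF ll T ae sc C max_speed_nonneg] t)
         (auto simp: terminal mult.commute)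
    thus "V t S \<le> w t S" by (simp add: Veq)
  qed
qed

end

section \<open>Feedback control\<close>

text \<open>After the last time before \<open>s\<close> at which the two agree, X stays above Y and
  therefore decreases at least as fast, so it cannot end strictly above. Monotonicity of
  \<open>r\<close> takes the place of a Lipschitz bound, since the feedback rate may jump.\<close>

lemma monotone_decay_comparison:
  fixes r :: "real \<Rightarrow> real \<Rightarrow> real" and X Y :: "real \<Rightarrow> real"
  assumes mono: "\<And>u x y. u \<in> {t..T} \<Longrightarrow> x \<le> y \<Longrightarrow> r u x \<le> r u y"
    and intX: "(\<lambda>u. r u (X u)) integrable_on {t..T}" and intY: "(\<lambda>u. r u (Y u)) integrable_on {t..T}"
    and X: "\<And>s. s \<in> {t..T} \<Longrightarrow> X s = S - integral {t..s} (\<lambda>u. r u (X u))"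
    and Y: "\<And>s. s \<in> {t..T} \<Longrightarrow> Y s = S - integral {t..s} (\<lambda>u. r u (Y u))"
    and s: "s \<in> {t..T}"
  shows "X s \<le> Y s"
proof (rule ccontr)
  assume less: "\<not> X s \<le> Y s"
  define D where "D u = X u - Y u" for u
  have cont: "continuous_on {t..T} D"
  proof -
    have "continuous_on {t..T} (\<lambda>s. (S - integral {t..s} (\<lambda>u. r u (X u))) - (S - integral {t..s} (\<lambda>u. r u (Y u))))"
      by (intro continuous_intros indefinite_integral_continuous_1 intX intY)
    thus ?thesis by (rule continuous_on_eq) (simp add: D_def X Y)
  qed
  define Z where "Z = {u \<in> {t..s}. D u = 0}"
  have conts: "continuous_on {t..s} D" using s by (intro continuous_on_subset[OF cont]) auto
  have "closed Z"
    unfolding Z_def by (intro continuous_closed_preimage_constant conts closed_atLeastAtMost)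
  hence "compact ({t..s} \<inter> Z)" by (intro compact_Int_closed compact_Icc)
  moreover have "{t..s} \<inter> Z = Z" by (auto simp: Z_def)
  ultimately have "compact Z" by simp
  moreover have "t \<in> Z" using s X[of t] Y[of t] by (simp add: Z_def D_def)
  ultimately obtain s0 where s0: "s0 \<in> Z" "\<And>u. u \<in> Z \<Longrightarrow> u \<le> s0"
    using compact_attains_sup[of Z] by blast
  have Dpos: "D u \<ge> 0" if u: "u \<in> {s0..s}" for u
  proof (rule ccontr)
    assume "\<not> 0 \<le> D u"
    moreover have "0 \<le> D s" using less by (simp add: D_def)
    ultimately obtain v where "u \<le> v" "v \<le> s" "D v = 0"
      using IVT'[of D u 0 s] continuous_on_subset[OF conts, of "{u..s}"] u s0(1) by (force simp: Z_def)
    hence "v \<in> Z" using u s0(1) by (auto simp: Z_def)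
    hence "v = u" "u = s0" using s0(2)[of v] u \<open>u \<le> v\<close> by auto
    with \<open>D v = 0\<close> \<open>\<not> 0 \<le> D u\<close> show False by simp
  qed
  have sub: "{s0..s} \<subseteq> {t..T}" and s0t: "t \<le> s0" "s0 \<le> s" using s s0(1) by (auto simp: Z_def)
  have int: "(\<lambda>u. r u (X u)) integrable_on {a..b}" "(\<lambda>u. r u (Y u)) integrable_on {a..b}"
    if "{a..b} \<subseteq> {t..T}" for a b
    using that by (auto intro: integrable_on_subinterval intX intY)
  have "integral {s0..s} (\<lambda>u. r u (Y u)) \<le> integral {s0..s} (\<lambda>u. r u (X u))"
    using Dpos sub by (intro integral_le int mono) (auto simp: D_def)
  moreover have "integral {t..s} (\<lambda>u. r u (X u)) = integral {t..s0} (\<lambda>u. r u (X u)) + integral {s0..s} (\<lambda>u. r u (X u))"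
    "integral {t..s} (\<lambda>u. r u (Y u)) = integral {t..s0} (\<lambda>u. r u (Y u)) + integral {s0..s} (\<lambda>u. r u (Y u))"
    using s0t s by (auto intro!: Henstock_Kurzweil_Integration.integral_combine[symmetric] int)
  ultimately have "D s \<le> D s0"
    using X[OF s] Y[OF s] X[of s0] Y[of s0] s0t s by (simp add: D_def)
  thus False using less s0(1) by (simp add: D_def Z_def)
qed

lemma set_integral_step:
  fixes g m :: real
  assumes "t \<le> \<tau>" "t \<le> s"
  shows "(LINT u:{t..s}|lebesgue. (if u < \<tau> then g else m)) = g * (min s \<tau> - t) + m * (s - min s \<tau>)"
proof -
  have "(LINT u:{t..s}|lebesgue. (if u < \<tau> then g else m))
      = (LINT u|lebesgue. indicator {t..s} u *\<^sub>R g + indicator {\<tau>..s} u *\<^sub>R (m - g))"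
    unfolding set_lebesgue_integral_def
    using assms by (intro Bochner_Integration.integral_cong) (auto simp: indicator_def)
  also have "\<dots> = (LINT u:{t..s}|lebesgue. g) + (LINT u:{\<tau>..s}|lebesgue. m - g)"
    using set_integrable_const_interval[of t s g] set_integrable_const_interval[of \<tau> s "m - g"]
    unfolding set_lebesgue_integral_def set_integrable_def by (rule Bochner_Integration.integral_add)
  also have "\<dots> = (s - t) * g + (s - min s \<tau>) * (m - g)"
    using assms set_integral_const_interval[of \<tau> s "m - g"]
    by (simp add: set_integral_const_interval min_def set_lebesgue_integral_def)
  finally show ?thesis by (simp add: algebra_simps)
qed

context execution_problem
begin

text \<open>On the region of ample cash \<open>opt\<close> is 0, and for
  \<open>\<alpha> j = 0\<close> the threshold at 0 would be 0, whereas the optimal control is to be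
  infinite there; hence the separate case.\<close>

definition feedback :: "nat \<Rightarrow> real \<Rightarrow> real \<Rightarrow> ennreal" where
  "feedback j t S = (if max_speed * (T - t) \<le> S then \<infinity> else thr (opt t S) j)"

definition rate :: "real \<Rightarrow> real \<Rightarrow> real" where
  "rate t S = speed (\<lambda>j. feedback j t S)"

lemma rate_eq: "rate t S = (if max_speed * (T - t) \<le> S then max_speed else slope (opt t S))"
  by (simp add: rate_def feedback_def max_speed_def slope_def)

lemma rate_mono: "t \<le> T \<Longrightarrow> S \<le> S' \<Longrightarrow> rate t S \<le> rate t S'"
  unfolding rate_eq using optimal_slope_mono[OF _ opt opt, of t S S'] opt_nonpos[of t S']
  by (auto simp: slope_le_max intro: slope_mono)

lemma closed_loop_trajectory_rate:
  assumes "closed_loop_trajectory J T lam f feedback t S X"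
  shows "(\<lambda>u. rate u (X u)) integrable_on {t..T}"
    and "\<And>s. s \<in> {t..T} \<Longrightarrow> X s = S - integral {t..s} (\<lambda>u. rate u (X u))"
proof -
  have adm: "admissible J T t (\<lambda>j s. feedback j s (X s))"
    and X: "\<And>s. s \<in> {t..T} \<Longrightarrow> X s = state J lam f (\<lambda>j s. feedback j s (X s)) t S s"
    using assms by (auto simp: closed_loop_trajectory_def)
  note int = integral_speed(1)[OF adm, folded rate_def]
  show "(\<lambda>u. rate u (X u)) integrable_on {t..T}"
    using set_lebesgue_integral_eq_integral(1)[OF int[OF order_refl]] .
  fix s assume s: "s \<in> {t..T}"
  hence "X s = S - (LINT u:{t..s}|lebesgue. rate u (X u))"
    using X[OF s] state_eq[OF adm, of s S] by (simp add: rate_def)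
  thus "X s = S - integral {t..s} (\<lambda>u. rate u (X u))"
    using set_lebesgue_integral_eq_integral(2)[OF int, of s] s by simp
qed

lemma closed_loop_trajectory_unique:
  assumes "closed_loop_trajectory J T lam f feedback t S X"
    and "closed_loop_trajectory J T lam f feedback t S Y" and "s \<in> {t..T}"
  shows "X s = Y s"
proof -
  have *: "X s \<le> Y s" if "closed_loop_trajectory J T lam f feedback t S X"
    "closed_loop_trajectory J T lam f feedback t S Y" for X Y
    by (rule monotone_decay_comparison[where r = rate and t = t and T = T])
       (use assms(3) closed_loop_trajectory_rate[OF that(1)] closed_loop_trajectory_rate[OF that(2)]
         in \<open>auto intro: rate_mono\<close>)
  show ?thesis by (rule antisym[OF *[OF assms(1,2)] *[OF assms(2,1)]])
qed

text \<open>
  The optimal state moves at constant speed, except that for \<open>opt t S = 0\<close> it may hit the line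
  \<open>S = max_speed * (T - s)\<close>, from which point on it follows that line.
\<close>

lemma optimal_state_exists:
  assumes t: "t \<le> T"
  obtains \<tau> X where "t \<le> \<tau>"
    "\<And>s. X s = S - (slope (opt t S) * (min s \<tau> - t) + max_speed * (s - min s \<tau>))"
    "\<And>s j. t \<le> s \<Longrightarrow> s \<le> T \<Longrightarrow> s < \<tau> \<Longrightarrow> feedback j s (X s) = thr (opt t S) j"
    "\<And>s j. t \<le> s \<Longrightarrow> s \<le> T \<Longrightarrow> \<tau> \<le> s \<Longrightarrow> feedback j s (X s) = \<infinity> \<and> opt t S = 0"
    "opt t S < 0 \<Longrightarrow> X T = opt t S / (2 * K)" "opt t S = 0 \<Longrightarrow> X T \<ge> 0"
proof -
  define x where "x = opt t S"
  have x: "x \<le> 0" "\<Psi> t x \<le> S" "x < 0 \<Longrightarrow> S = \<Psi> t x"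
    using opt[OF t, of S] by (auto simp: x_def optimal_slope_def)
  have slope_le: "(T - s) * slope y \<le> (T - s) * max_speed" if "s \<le> T" for s y
    using that slope_le_max by (intro mult_left_mono) auto
  consider (fast) "max_speed * (T - t) \<le> S" | (slow) "S < max_speed * (T - t)" "x < 0"
    | (switch) "S < max_speed * (T - t)" "x = 0"
    using x(1) by linarith
  thus thesis
  proof cases
    case fast
    have "optimal_slope t S 0"
      using fast slope_le[OF t, of 0] by (simp add: optimal_slope_def \<Psi>_def mult.commute)
    hence x0: "opt t S = 0" by (rule opt_eqI[OF t])
    show thesis
      by (rule that[of t "\<lambda>s. S - (slope (opt t S) * (min s t - t) + max_speed * (s - min s t))"])
         (use fast x0 t in \<open>auto simp: feedback_def min_def algebra_simps\<close>)
  next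
    case slow
    have S: "S = (T - t) * slope x + x / (2 * K)" using x(3)[OF slow(2)] by (simp add: \<Psi>_def)
    have neg: "x / (2 * K) < 0" using slow(2) K by (simp add: divide_neg_pos)
    \<comment> \<open>Along this straight line the state equals \<open>\<Psi> s x\<close>, so
      \<open>opt\<close> keeps the value \<open>x\<close> and the feedback stays constant.\<close>
    have fb: "feedback j s (S - slope x * (s - t)) = thr x j" if "s \<le> T" for s j
    proof -
      have eq: "S - slope x * (s - t) = \<Psi> s x" by (simp add: S \<Psi>_def algebra_simps)
      have "\<Psi> s x < max_speed * (T - s)"
        using slope_le[OF that, of x] neg by (simp add: \<Psi>_def mult.commute)
      moreover have "opt s (\<Psi> s x) = x"
        using slow(2) by (intro opt_eqI that) (simp add: optimal_slope_def)
      ultimately show ?thesis by (simp add: feedback_def eq)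
    qed
    \<comment> \<open>A switching time beyond the horizon means that the switch never
      happens.\<close>
    show thesis
      by (rule that[of "T + 1" "\<lambda>s. S - (slope x * (min s (T + 1) - t) + max_speed * (s - min s (T + 1)))",
            folded x_def])
         (use t fb slow(2) S in \<open>auto simp: min_def algebra_simps\<close>)
  next
    case switch
    \<comment> \<open>The cash that would be left at \<open>T\<close> if the rate
      \<open>slope 0\<close> were kept throughout.\<close>
    define c where "c = S - (T - t) * slope 0"
    have c: "c \<ge> 0" using x(2) switch(2) by (simp add: c_def \<Psi>_def)
    have c_less: "c < (T - t) * (max_speed - slope 0)" using switch(1) by (simp add: c_def algebra_simps)
    have gap: "max_speed - slope 0 > 0"
      using c c_less slope_le_max[of 0] t by (cases "max_speed = slope 0") auto
    \<comment> \<open>The time at which the state \<open>(T - s) * slope 0 + c\<close> meets the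
      line \<open>(T - s) * max_speed\<close>.\<close>
    define \<tau> where "\<tau> = T - c / (max_speed - slope 0)"
    have ctau: "c = (T - \<tau>) * (max_speed - slope 0)" using gap by (simp add: \<tau>_def)
    have "c / (max_speed - slope 0) < T - t" using c_less gap by (simp add: pos_divide_less_eq)
    hence \<tau>: "t < \<tau>" by (simp add: \<tau>_def)
    have \<tau>T: "\<tau> \<le> T" using c gap by (simp add: \<tau>_def)
    have before: "S - slope 0 * (s - t) = (T - s) * slope 0 + c" for s by (simp add: c_def algebra_simps)
    have after: "S - (slope 0 * (\<tau> - t) + max_speed * (s - \<tau>)) = (T - s) * max_speed" for s
    proof -
      have "S = (T - t) * slope 0 + (T - \<tau>) * (max_speed - slope 0)" using ctau by (simp add: c_def)
      thus ?thesis by (simp add: algebra_simps)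
    qed
    have fb: "feedback j s (S - slope 0 * (s - t)) = thr 0 j" if "s \<le> T" "s < \<tau>" for s j
    proof -
      have "c < (T - s) * (max_speed - slope 0)"
        unfolding ctau using that gap by (intro mult_strict_right_mono) auto
      hence "\<not> max_speed * (T - s) \<le> (T - s) * slope 0 + c" by (simp add: algebra_simps)
      moreover have "opt s ((T - s) * slope 0 + c) = 0"
        using c by (intro opt_eqI that) (simp add: optimal_slope_def \<Psi>_def)
      ultimately show ?thesis by (simp add: feedback_def before)
    qed
    define X where "X s = S - (slope 0 * (min s \<tau> - t) + max_speed * (s - min s \<tau>))" for s
    have X_before: "X s = S - slope 0 * (s - t)" if "s < \<tau>" for s
      using that by (simp add: X_def)
    have X_after: "X s = (T - s) * max_speed" if "\<tau> \<le> s" for s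
      using that after[of s] by (simp add: X_def min_absorb2)
    show thesis
      by (rule that[of \<tau> X, folded x_def, unfolded switch(2)])
         (use \<tau> \<tau>T fb in \<open>auto simp: X_before X_after feedback_def[of _ _ "_ * _"] mult.commute[of _ max_speed] X_def[symmetric]\<close>)
  qed
qed

lemma closed_loop_trajectory_exists:
  assumes t: "t \<le> T"
  obtains X where "closed_loop_trajectory J T lam f feedback t S X"
    "\<And>u. u \<in> {t..T} \<Longrightarrow> reward (\<lambda>j. feedback j u (X u)) + opt t S * speed (\<lambda>j. feedback j u (X u)) = H (opt t S)"
    "opt t S < 0 \<Longrightarrow> X T = opt t S / (2 * K)" "opt t S = 0 \<Longrightarrow> X T \<ge> 0"
proof -
  define x where "x = opt t S"
  obtain \<tau> X where \<tau>: "t \<le> \<tau>"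
    and X: "\<And>s. X s = S - (slope x * (min s \<tau> - t) + max_speed * (s - min s \<tau>))"
    and before: "\<And>s j. t \<le> s \<Longrightarrow> s \<le> T \<Longrightarrow> s < \<tau> \<Longrightarrow> feedback j s (X s) = thr x j"
    and after: "\<And>s j. t \<le> s \<Longrightarrow> s \<le> T \<Longrightarrow> \<tau> \<le> s \<Longrightarrow> feedback j s (X s) = \<infinity> \<and> x = 0"
    and final: "x < 0 \<Longrightarrow> X T = x / (2 * K)" "x = 0 \<Longrightarrow> X T \<ge> 0"
    unfolding x_def by (rule optimal_state_exists[OF t, of S]) blast
  have fb: "feedback j s (X s) = (if s < \<tau> then thr x j else \<infinity>)" if "s \<in> {t..T}" for j s
    using before[of s j] after[of s j] that by auto
  have adm: "admissible J T t (\<lambda>j s. feedback j s (X s))"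
    unfolding admissible_def
  proof
    fix j
    have "(\<lambda>s::real. if s < \<tau> then thr x j else \<infinity>) \<in> borel_measurable lborel" by measurable
    hence "(\<lambda>s::real. if s < \<tau> then thr x j else \<infinity>) \<in> borel_measurable (lebesgue_on {t..T})"
      by (intro measurable_restrict_space1 measurable_completion)
    thus "(\<lambda>s. feedback j s (X s)) \<in> borel_measurable (lebesgue_on {t..T})"
      by (rule measurable_cong[THEN iffD1, rotated]) (simp add: fb space_restrict_space)
  qed
  have "X s = state J lam f (\<lambda>j s. feedback j s (X s)) t S s" if s: "s \<in> {t..T}" for s
  proof -
    have "(LINT u:{t..s}|lebesgue. speed (\<lambda>j. feedback j u (X u)))
        = (LINT u:{t..s}|lebesgue. (if u < \<tau> then slope x else max_speed))"
      using s by (intro set_lebesgue_integral_cong) (auto simp: fb slope_def max_speed_def)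
    also have "\<dots> = slope x * (min s \<tau> - t) + max_speed * (s - min s \<tau>)"
      using s by (intro set_integral_step \<tau>) auto
    finally show ?thesis using s X[of s] state_eq[OF adm, of s S] by simp
  qed
  hence "closed_loop_trajectory J T lam f feedback t S X"
    using adm by (simp add: closed_loop_trajectory_def)
  moreover have "reward (\<lambda>j. feedback j u (X u)) + x * speed (\<lambda>j. feedback j u (X u)) = H x"
    if u: "u \<in> {t..T}" for u
  proof (cases "u < \<tau>")
    case True
    thus ?thesis using u H_threshold[OF opt_nonpos[OF t, of S]] by (simp add: fb slope_def x_def)
  next
    case False
    \<comment> \<open>After the switch the multiplier is 0: spending has no price, and infinite
      values also attain \<open>H 0\<close>.\<close>
    thus ?thesis using u after[of u] H_infinity[of 0] by (simp add: fb)
  qed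
  ultimately show thesis using that final unfolding x_def by blast
qed

lemma feedback_optimal: "optimal_control_function J T K lam \<alpha> f feedback"
  unfolding optimal_control_function_def
proof (intro ballI allI)
  fix t S assume t: "t \<in> {0..T}"
  then obtain Y where Y: "closed_loop_trajectory J T lam f feedback t S Y"
    "\<And>u. u \<in> {t..T} \<Longrightarrow> reward (\<lambda>j. feedback j u (Y u)) + opt t S * speed (\<lambda>j. feedback j u (Y u)) = H (opt t S)"
    "opt t S < 0 \<Longrightarrow> Y T = opt t S / (2 * K)" "opt t S = 0 \<Longrightarrow> Y T \<ge> 0"
    using closed_loop_trajectory_exists[of t S] by auto
  have "cost J T K lam \<alpha> f (\<lambda>j s. feedback j s (X s)) t S = value_fun J T K lam \<alpha> f t S"
    if X: "closed_loop_trajectory J T lam f feedback t S X" for X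
  proof -
    have XY: "X u = Y u" if "u \<in> {t..T}" for u by (rule closed_loop_trajectory_unique[OF X Y(1) that])
    have adm: "admissible J T t (\<lambda>j s. feedback j s (X s))"
      and XT: "state J lam f (\<lambda>j s. feedback j s (X s)) t S T = Y T"
      using X XY[of T] t by (auto simp: closed_loop_trajectory_def)
    have "cost J T K lam \<alpha> f (\<lambda>j s. feedback j s (X s)) t S = dual_objective t S (opt t S)"
      using t Y(2-4) XY by (intro cost_eq_dual_objective adm) (auto simp: XT opt_nonpos)
    thus ?thesis using t by (simp add: value_fun_eq_V V_def)
  qed
  thus "(\<exists>X. closed_loop_trajectory J T lam f feedback t S X) \<and>
       (\<forall>X. closed_loop_trajectory J T lam f feedback t S X \<longrightarrow>
          cost J T K lam \<alpha> f (\<lambda>j s. feedback j s (X s)) t S = value_fun J T K lam \<alpha> f t S)"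
    using Y(1) by blast
qed

section \<open>Characterisation of the optimal slope by slopes of H\<close>

text \<open>The two ends are the one-sided slopes at the kink. For \<open>y \<le> 0\<close> the
  minorant with slope \<open>slope 0\<close> dominates the line, for \<open>y > 0\<close> the one
  with slope \<open>max_speed\<close> does.\<close>

lemma subdifferential_H_zero:
  assumes "slope 0 \<le> d" "d \<le> max_speed"
  shows "d \<in> subdifferential H 0"
  unfolding subdifferential_def
proof (clarify, goal_cases)
  case (1 y)
  show ?case
  proof (cases "y \<le> 0")
    case True
    hence "d * y \<le> slope 0 * y" using assms(1) by (intro mult_right_mono_neg) auto
    thus ?thesis using H_subgradient_nonpos[of 0 y] by simp
  next
    case False
    hence "d * y \<le> max_speed * y" using assms(2) by (intro mult_right_mono) auto
    thus ?thesis using H_subgradient_nonneg[of 0 y] by simp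
  qed
qed

text \<open>Uniqueness follows because slopes of a convex function are monotone while
  \<open>y / (2 * K)\<close> is strictly increasing. This covers every real \<open>y\<close>, not
  only nonpositive ones.\<close>

lemma subdifferential_equation_iff:
  assumes t: "t \<le> T" and S: "S < max_speed * (T - t)"
  shows "(\<exists>d\<in>subdifferential H y. S = (T - t) * d + y / (2 * K)) \<longleftrightarrow> y = opt t S"
proof -
  define x where "x = opt t S"
  have x: "x \<le> 0" "\<Psi> t x \<le> S" "x < 0 \<Longrightarrow> S = \<Psi> t x"
    using opt[OF t, of S] by (auto simp: x_def optimal_slope_def)
  have ex: "\<exists>d\<in>subdifferential H x. S = (T - t) * d + x / (2 * K)"
  proof (cases "x < 0")
    case True
    have "slope x \<in> subdifferential H x"
      using H_subgradient_nonpos[OF x(1)] by (simp add: subdifferential_def)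
    thus ?thesis using x(3)[OF True] by (auto simp: \<Psi>_def)
  next
    case False
    hence x0: "x = 0" using x(1) by simp
    hence Sge: "(T - t) * slope 0 \<le> S" using x(2) by (simp add: \<Psi>_def)
    have tT: "t < T" using t S Sge by (cases "t = T") auto
    \<comment> \<open>At \<open>x = 0\<close> the equation forces this slope. It lies between
      \<open>slope 0\<close>, by the first order condition, and \<open>max_speed\<close>, by the
      assumption on \<open>S\<close>.\<close>
    have "S / (T - t) \<in> subdifferential H 0"
      using tT S Sge by (intro subdifferential_H_zero) (simp_all add: field_simps)
    thus ?thesis using tT by (auto simp: x0 intro!: bexI[of _ "S / (T - t)"])
  qed
  have uniq: "y = y'"
    if d: "d \<in> subdifferential H y" "d' \<in> subdifferential H y'"
      "S = (T - t) * d + y / (2 * K)" "S = (T - t) * d' + y' / (2 * K)" for d d' y y'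
  proof -
    have "H y + d * (y' - y) \<le> H y'" "H y' + d' * (y - y') \<le> H y"
      using d(1,2) by (auto simp: subdifferential_def)
    hence "0 \<le> (d - d') * (y - y')" by (simp add: algebra_simps)
    hence "0 \<le> (T - t) * ((d - d') * (y - y'))" using t by simp
    moreover have "(T - t) * (d - d') = - ((y - y') / (2 * K))"
      using d(3,4) by (simp add: algebra_simps diff_divide_distrib)
    hence "(T - t) * ((d - d') * (y - y')) = - ((y - y')\<^sup>2 / (2 * K))"
      by (simp add: mult.assoc[symmetric] power2_eq_square)
    ultimately have "(y - y')\<^sup>2 \<le> 0" using K by (simp add: zero_le_divide_iff divide_le_0_iff)
    thus ?thesis by simp
  qed
  show ?thesis using ex uniq unfolding x_def by blast
qed

text \<open>Subtracting a line with a subgradient slope from H leaves a function with a minimum at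
  \<open>y\<close>, so the derivative must coincide with that subgradient.\<close>

lemma deriv_mem_subdifferential_H:
  assumes "H differentiable (at y)"
  shows "deriv H y \<in> subdifferential H y"
proof -
  obtain d where d: "\<And>z. H y + d * (z - y) \<le> H z" using H_subgradient_exists by blast
  have "(H has_real_derivative deriv H y) (at y)"
    using assms DERIV_deriv_iff_real_differentiable by blast
  hence "((\<lambda>z. H z - d * z) has_real_derivative deriv H y - d) (at y)"
    by (auto intro!: derivative_eq_intros)
  moreover have "H y - d * y \<le> H z - d * z" for z using d[of z] by (simp add: algebra_simps)
  ultimately have "deriv H y - d = 0"
    by (intro DERIV_local_min[of _ _ y 1]) auto
  thus ?thesis using d by (simp add: subdifferential_def)
qed

text \<open>Any solution of the derivative equation also solves the one with the subdifferential,
  whose solution is unique; this rules out solutions with \<open>y \<ge> 0\<close> as well.\<close>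

lemma derivative_equation_iff:
  assumes t: "t \<le> T" and S: "S < max_speed * (T - t)" and neg: "opt t S < 0"
  shows "H differentiable (at y) \<and> S = (T - t) * deriv H y + y / (2 * K) \<longleftrightarrow> y = opt t S"
proof
  assume "H differentiable (at y) \<and> S = (T - t) * deriv H y + y / (2 * K)"
  thus "y = opt t S"
    using subdifferential_equation_iff[OF t S, of y] deriv_mem_subdifferential_H by blast
next
  assume y: "y = opt t S"
  have "(H has_real_derivative slope y) (at y)" using neg by (simp add: y H_has_derivative)
  moreover from this have "deriv H y = slope y" by (rule DERIV_imp_deriv)
  moreover have "S = \<Psi> t y" using opt[OF t, of S] neg by (simp add: y optimal_slope_def)
  ultimately show "H differentiable (at y) \<and> S = (T - t) * deriv H y + y / (2 * K)"
    by (auto simp: \<Psi>_def real_differentiable_def)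
qed

text \<open>When no \<open>\<alpha> j\<close> vanishes, the left derivative of H at 0 is already
  \<open>max_speed\<close>, so the first order condition at 0 would require \<open>S\<close> to be
  at least \<open>max_speed * (T - t)\<close>.\<close>

lemma opt_negative:
  assumes "t \<le> T" "S < max_speed * (T - t)" "\<And>j. j \<in> {1..J} \<Longrightarrow> \<alpha> j > 0"
  shows "opt t S < 0"
proof (rule ccontr)
  assume "\<not> opt t S < 0"
  hence "opt t S = 0" using opt_nonpos[OF assms(1), of S] by simp
  hence "(T - t) * slope 0 \<le> S" using opt[OF assms(1), of S] by (simp add: optimal_slope_def \<Psi>_def)
  thus False using assms(2) slope_zero_eq_max_speed[OF assms(3)] by (simp add: mult.commute)
qed

lemma max_speed_time_eq:
  "(\<Sum>j=1..J. lam j * (T - t) * (LINT p:{0<..}|lborel. p * f j p)) = max_speed * (T - t)"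
  by (simp add: max_speed_eq sum_distrib_left mult_ac)

end

theorem mainTheorem2:
  fixes J :: nat and T K :: real
    and lam \<alpha> :: "nat \<Rightarrow> real" and f :: "nat \<Rightarrow> real \<Rightarrow> real"
  assumes J: "J > 1" and T: "T > 0" and K: "K > 0"
    and lam: "\<And>j. j \<in> {1..J} \<Longrightarrow> lam j > 0"
    and alpha: "\<And>j. j \<in> {1..J} \<Longrightarrow> \<alpha> j \<ge> 0"
    and density: "\<And>j. j \<in> {1..J} \<Longrightarrow> density_on_pos (f j)"
    and f_pos: "\<And>j p. j \<in> {1..J} \<Longrightarrow> p > 0 \<Longrightarrow> f j p > 0"
    and f_decay: "\<And>j. j \<in> {1..J} \<Longrightarrow> ((\<lambda>p. p ^ 3 * f j p) \<longlongrightarrow> 0) at_top"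
  shows
    "(\<forall>t\<in>{0..T}. \<forall>S. value_fun J T K lam \<alpha> f t S =
        (SUP x\<in>{..0}. S * x - (T - t) * hamiltonian J lam \<alpha> f x - x\<^sup>2 / (4 * K)))
     \<and> weak_semiconcave_solution J T K lam \<alpha> f (value_fun J T K lam \<alpha> f)
     \<and> (\<forall>w. weak_semiconcave_solution J T K lam \<alpha> f w \<longrightarrow>
          (\<forall>t\<in>{0..T}. \<forall>S. w t S = value_fun J T K lam \<alpha> f t S))
     \<and> (\<exists>\<beta>. optimal_control_function J T K lam \<alpha> f \<beta>
          \<and> (\<forall>t\<in>{0..T}. \<forall>S.
               S \<ge> (\<Sum>j=1..J. lam j * (T - t) * (LINT p:{0<..}|lborel. p * f j p)) \<longrightarrow>
               (\<forall>j\<in>{1..J}. \<beta> j t S = \<infinity>))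
          \<and> (\<forall>t\<in>{0..T}. \<forall>S.
               S < (\<Sum>j=1..J. lam j * (T - t) * (LINT p:{0<..}|lborel. p * f j p)) \<longrightarrow>
               (\<exists>x\<le>0.
                  \<comment> \<open>where H is differentiable, as it is away from 0 and, if no \<open>\<alpha> j\<close> vanishes, at 0\<close>
                  (x < 0 \<longrightarrow>
                     (\<forall>y. hamiltonian J lam \<alpha> f differentiable (at y) \<and>
                          S = (T - t) * deriv (hamiltonian J lam \<alpha> f) y + y / (2 * K)
                          \<longleftrightarrow> y = x)) \<and>
                  ((\<forall>j\<in>{1..J}. \<alpha> j > 0) \<longrightarrow> x < 0) \<and>
                  \<comment> \<open>in general, with the subdifferential in place of the derivative\<close>
                  (\<forall>y. (\<exists>d\<in>subdifferential (hamiltonian J lam \<alpha> f) y.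
                          S = (T - t) * d + y / (2 * K)) \<longleftrightarrow> y = x) \<and>
                  \<comment> \<open>\<open>-\<alpha> j / x\<close> in the extended half-line; for x = 0 it is infinity if \<open>\<alpha> j > 0\<close>, and 0 if \<open>\<alpha> j = 0\<close>\<close>
                  (\<forall>j\<in>{1..J}. \<beta> j t S = ennreal (\<alpha> j) / ennreal (- x)))))"
proof -
  interpret execution_problem J T K lam \<alpha> f
    by unfold_locales (use T K lam alpha density f_decay in auto)
  show ?thesis
    unfolding max_speed_time_eq
  proof (intro conjI ballI allI impI exI[of _ feedback])
    fix t S assume "t \<in> {0..T}"
    thus "value_fun J T K lam \<alpha> f t S = (SUP x\<in>{..0}. S * x - (T - t) * H x - x\<^sup>2 / (4 * K))"
      by (simp add: value_fun_eq_V V_eq_SUP)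
  next
    fix w t S assume "weak_semiconcave_solution J T K lam \<alpha> f w" "t \<in> {0..T}"
    thus "w t S = value_fun J T K lam \<alpha> f t S"
      by (simp add: value_fun_eq_V weak_semiconcave_solution_unique)
  next
    fix t S j assume "max_speed * (T - t) \<le> S"
    thus "feedback j t S = \<infinity>" by (simp add: feedback_def)
  next
    fix t S assume t: "t \<in> {0..T}" and S: "S < max_speed * (T - t)"
    hence t': "t \<le> T" by simp
    show "\<exists>x\<le>0. (x < 0 \<longrightarrow> (\<forall>y. H differentiable (at y) \<and> S = (T - t) * deriv H y + y / (2 * K) \<longleftrightarrow> y = x)) \<and>
        ((\<forall>j\<in>{1..J}. \<alpha> j > 0) \<longrightarrow> x < 0) \<and>
        (\<forall>y. (\<exists>d\<in>subdifferential H y. S = (T - t) * d + y / (2 * K)) \<longleftrightarrow> y = x) \<and>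
        (\<forall>j\<in>{1..J}. feedback j t S = ennreal (\<alpha> j) / ennreal (- x))"
      using opt_nonpos[OF t', of S] derivative_equation_iff[OF t' S] opt_negative[OF t' S]
        subdifferential_equation_iff[OF t' S] S
      by (intro exI[of _ "opt t S"]) (auto simp: feedback_def thr_def threshold_def)
  qed (rule value_fun_weak_semiconcave_solution feedback_optimal)+
qed

end
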